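(* Let $d\ge 2$ and let $\{C_t\}_{t\in\mathbb{R}P^1}$ be a generic real pencil of plane curves of degree $d$ whose $d^2$ base points are distinct, with exactly $2r$ of them non-real (forming $r$ pairs of complex conjugate points), and such that every singular member has exactly one node, which is not a base point. Let $N_{cr}$ be the number of real members whose node is a real non-solitary node (two real branches) and $N_{sol}$ the number of real members whose node is solitary (locally $x^2+y^2=0$ over $\mathbb{R}$). Then $N_{cr}-N_{sol}=d^2-1-2r$. In particular, if all base points are real, the pencil contains at least $d^2-1$ real nodal curves.
   Context: A real pencil is a one-parameter linear family $\{sF+tG\}$ with $F,G$ real homogeneous polynomials of degree $d$; its base points are the common zeros of $F$ and $G$. *)

theory Defs
  imports "HOL-Analysis.Analysis"
begin

text \<open>Homogeneous ternary forms of degree d are represented by coefficient functions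
  on exponent vectors e :: nat^3; only monomials with total degree d are used.\<close>

definition mono :: "complex^3 \<Rightarrow> nat^3 \<Rightarrow> complex" where
  "mono v e = (\<Prod>m\<in>UNIV. (v$m) ^ (e$m))"

definition degd :: "nat \<Rightarrow> (nat^3) set" where
  "degd d = {e. (\<Sum>m\<in>UNIV. e$m) = d}"

definition heval :: "nat \<Rightarrow> (nat^3 \<Rightarrow> complex) \<Rightarrow> complex^3 \<Rightarrow> complex" where
  "heval d c v = (\<Sum>e\<in>degd d. c e * mono v e)"

definition dexp :: "3 \<Rightarrow> nat^3 \<Rightarrow> nat^3" where
  "dexp k e = (\<chi> m. if m = k then e$m - 1 else e$m)"

definition hgrad :: "nat \<Rightarrow> (nat^3 \<Rightarrow> complex) \<Rightarrow> 3 \<Rightarrow> complex^3 \<Rightarrow> complex" where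
  "hgrad d c k v = (\<Sum>e\<in>degd d. c e * of_nat (e$k) * mono v (dexp k e))"

definition hhess :: "nat \<Rightarrow> (nat^3 \<Rightarrow> complex) \<Rightarrow> 3 \<Rightarrow> 3 \<Rightarrow> complex^3 \<Rightarrow> complex" where
  "hhess d c k l v = (\<Sum>e\<in>degd d. c e * of_nat (e$k) * of_nat ((dexp k e)$l)
                                    * mono v (dexp l (dexp k e)))"

definition hessian :: "nat \<Rightarrow> (nat^3 \<Rightarrow> complex) \<Rightarrow> complex^3 \<Rightarrow> complex^3^3" where
  "hessian d c v = (\<chi> k l. hhess d c k l v)"

definition ppt :: "complex^3 \<Rightarrow> (complex^3) set" where
  "ppt v = {a *s v | a. a \<noteq> 0}"

definition realvec :: "complex^3 \<Rightarrow> bool" where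
  "realvec v \<longleftrightarrow> (\<forall>m. v$m \<in> \<real>)"

definition real_ppt :: "(complex^3) set \<Rightarrow> bool" where
  "real_ppt P \<longleftrightarrow> (\<exists>v\<in>P. realvec v)"

definition singular_pt :: "nat \<Rightarrow> (nat^3 \<Rightarrow> complex) \<Rightarrow> complex^3 \<Rightarrow> bool" where
  "singular_pt d c v \<longleftrightarrow> v \<noteq> 0 \<and> heval d c v = 0 \<and> (\<forall>k. hgrad d c k v = 0)"

text \<open>Node = ordinary double point: singular point with Hessian of rank 2
  (i.e. nondegenerate quadratic part in an affine chart).\<close>
definition node_pt :: "nat \<Rightarrow> (nat^3 \<Rightarrow> complex) \<Rightarrow> complex^3 \<Rightarrow> bool" where
  "node_pt d c v \<longleftrightarrow> singular_pt d c v \<and> rank (hessian d c v) = 2"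

definition tcone :: "nat \<Rightarrow> (nat^3 \<Rightarrow> complex) \<Rightarrow> complex^3 \<Rightarrow> real^3 \<Rightarrow> real" where
  "tcone d c v u = Re (\<Sum>k\<in>UNIV. \<Sum>l\<in>UNIV. hhess d c k l v * of_real (u$k) * of_real (u$l))"

definition cvec :: "real^3 \<Rightarrow> complex^3" where
  "cvec u = (\<chi> m. of_real (u$m))"

definition crossing_node :: "nat \<Rightarrow> (nat^3 \<Rightarrow> complex) \<Rightarrow> complex^3 \<Rightarrow> bool" where
  "crossing_node d c v \<longleftrightarrow> node_pt d c v \<and> realvec v \<and>
     (\<exists>u. tcone d c v u < 0) \<and> (\<exists>u. tcone d c v u > 0)"

definition solitary_node :: "nat \<Rightarrow> (nat^3 \<Rightarrow> complex) \<Rightarrow> complex^3 \<Rightarrow> bool" where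
  "solitary_node d c v \<longleftrightarrow> node_pt d c v \<and> realvec v \<and>
     (\<forall>u. tcone d c v u = 0 \<longrightarrow> (\<exists>a::complex. cvec u = a *s v))"

definition pmem :: "(nat^3 \<Rightarrow> real) \<Rightarrow> (nat^3 \<Rightarrow> real) \<Rightarrow> complex \<Rightarrow> complex \<Rightarrow> nat^3 \<Rightarrow> complex" where
  "pmem F G s t = (\<lambda>e. s * of_real (F e) + t * of_real (G e))"

text \<open>Real member indexed by theta in [0,pi), a parametrisation of RP^1.\<close>
definition rmem :: "(nat^3 \<Rightarrow> real) \<Rightarrow> (nat^3 \<Rightarrow> real) \<Rightarrow> real \<Rightarrow> nat^3 \<Rightarrow> complex" where
  "rmem F G \<theta> = pmem F G (of_real (cos \<theta>)) (of_real (sin \<theta>))"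

definition base_points :: "nat \<Rightarrow> (nat^3 \<Rightarrow> real) \<Rightarrow> (nat^3 \<Rightarrow> real) \<Rightarrow> (complex^3) set set" where
  "base_points d F G = {ppt v | v. v \<noteq> 0 \<and> heval d (pmem F G 1 0) v = 0 \<and> heval d (pmem F G 0 1) v = 0}"

end

theory Submission
  imports Defs
begin

text \<open>
  Only the real projective plane matters: the number of real base points is \<open>d\<^sup>2 - 2r\<close>, and, by uniqueness,
  the singular point of a real member equals its conjugate, so it is real. The vector field
  \<open>F \<nabla>G - G \<nabla>F\<close> vanishes exactly at the base points and at the singular points of the members.
  At a base point the differentials of \<open>F\<close> and \<open>G\<close> are independent (otherwise some member would be
  singular there), and the field turns like \<open>(-y, x)\<close>, of index \<open>1\<close>. At a node of a member \<open>H\<close> its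
  derivative is a nonzero multiple of the Hessian of \<open>H\<close>, so the index is \<open>1\<close> if the node is solitary and
  \<open>-1\<close> if it is a crossing. Pulled back to the closed unit disc by stereographic projection, with the
  circle going to a line that avoids all zeros, the field has an antipodal symmetry on the circle which
  forces it to wind exactly once. Hence the indices add up to \<open>1\<close>, the Euler characteristic of the projective plane.
\<close>

section \<open>Counting nondegenerate zeros on the disc\<close>

text \<open>Winding numbers are never defined; logarithms replace them. Each zero \<open>a\<close>
  is traded for a factor \<open>z - a\<close> or \<open>cnj (z - a)\<close>, and the quotient,
  altered near \<open>a\<close>, stays continuous and free of zeros, so on the whole disc it is an
  exponential. On the unit circle \<open>z - a = z * (1 - a * cnj z)\<close>, whose second factor
  also has a logarithm. Hence there the field is \<open>z ^ P * cnj z ^ N * exp (L z)\<close>, where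
  \<open>P\<close> and \<open>N\<close> count the zeros of index 1 and -1. The symmetry on the
  circle holds because antipodal points represent the same projective point and the field is
  homogeneous of the odd degree \<open>2 * d - 1\<close>. In the frame of radial and tangential
  directions it reads \<open>B (- z) = - cnj (B z)\<close>. Conjugation reverses winding and the
  antipodal map preserves it, so \<open>B\<close> does not wind at all; the frame itself turns once,
  and this is the 1 in the result.\<close>

lemma index_from_antipodal_symmetry:
  fixes W L :: "complex \<Rightarrow> complex" and P N :: nat
  assumes L: "continuous_on (sphere 0 1) L"
    and rep: "\<And>z. cmod z = 1 \<Longrightarrow> W z = z ^ P * cnj z ^ N * exp (L z)"
    and anti: "\<And>z. cmod z = 1 \<Longrightarrow> W (- z) * cnj (- z) = - cnj (W z * cnj z)"
  shows "int P - int N = 1"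
proof -
  \<comment> \<open>Multiplication by \<open>cnj z\<close> passes to the rotating frame of radial
    and tangential directions, whose own turn accounts for the \<open>- 1\<close>.\<close>
  define m where "m = real P - real N - 1"
  have B: "W (cis x) * cnj (cis x) = exp (\<i> * of_real (m * x) + L (cis x))" for x
  proof -
    have "W (cis x) * cnj (cis x) = cis (P * x) * cis (- (N * x)) * cis (- x) * exp (L (cis x))"
      by (simp add: rep cis_cnj Complex.DeMoivre del: cis_inverse)
    also have "cis (P * x) * cis (- (N * x)) * cis (- x) = cis (m * x)"
      by (simp add: cis_mult m_def algebra_simps)
    finally show ?thesis by (simp add: cis_conv_exp exp_add)
  qed
  \<comment> \<open>The symmetry equates two exponentials; \<open>u x\<close> is the multiple of
    \<open>2 * pi * \<i>\<close> by which their exponents differ.\<close>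
  define u where "u x = (m * (2 * x + pi) + Im (L (cis (x + pi))) + Im (L (cis x)) - pi) / (2 * pi)" for x
  have u_int: "u x \<in> \<int>" for x
  proof -
    have "exp (\<i> * of_real (m * (x + pi)) + L (cis (x + pi))) = W (cis (x + pi)) * cnj (cis (x + pi))"
      by (rule B[symmetric])
    also have "\<dots> = - cnj (W (cis x) * cnj (cis x))"
      using anti[of "cis x"] by (simp add: cis_mult[symmetric])
    also have "\<dots> = exp (\<i> * pi) * cnj (exp (\<i> * of_real (m * x) + L (cis x)))"
      unfolding B by simp
    also have "\<dots> = exp (\<i> * pi + cnj (\<i> * of_real (m * x) + L (cis x)))"
      by (simp only: exp_cnj exp_add[of "\<i> * complex_of_real pi"])
    finally obtain n :: int where
      n: "\<i> * of_real (m * (x + pi)) + L (cis (x + pi)) =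
        \<i> * pi + cnj (\<i> * of_real (m * x) + L (cis x)) + of_int (2 * n) * pi * \<i>"
      unfolding exp_eq by blast
    have "m * (x + pi) + Im (L (cis (x + pi))) = pi - (m * x + Im (L (cis x))) + 2 * n * pi"
      using arg_cong[OF n, of Im] by simp
    then have "u x = of_int n" by (simp add: u_def field_simps)
    then show ?thesis by simp
  qed
  have contL: "continuous_on UNIV (\<lambda>x. L (cis (g x)))" if "continuous_on UNIV g" for g :: "real \<Rightarrow> real"
    by (rule continuous_on_compose2[OF L]) (use that in \<open>auto intro!: continuous_intros simp: cis_conv_exp\<close>)
  have cont: "continuous_on UNIV u"
    unfolding u_def by (intro continuous_intros contL) auto
  have "u constant_on UNIV"
  proof (rule continuous_discrete_range_constant[OF connected_UNIV cont])
    fix x :: real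
    show "\<exists>e>0. \<forall>y. y \<in> UNIV \<and> u y \<noteq> u x \<longrightarrow> e \<le> norm (u y - u x)"
    proof (intro exI[of _ 1] conjI allI impI)
      fix y assume "y \<in> UNIV \<and> u y \<noteq> u x"
      moreover have "u y - u x \<in> \<int>" using u_int by auto
      ultimately show "1 \<le> norm (u y - u x)"
        by (simp add: Ints_nonzero_abs_ge1)
    qed simp
  qed
  then have "u 0 = u pi" by (metis UNIV_I constant_on_def)
  \<comment> \<open>From \<open>x = 0\<close> to \<open>x = pi\<close> the two \<open>L\<close>
    terms merely swap places, so \<open>u pi - u 0 = m\<close>.\<close>
  then have "m = 0" by (simp add: u_def field_simps cis.ctr complex_eq_iff cis_mult[symmetric])
  then show ?thesis unfolding m_def by linarith
qed

text \<open>\<open>\<mu> a\<close> is a model of the zero at \<open>a\<close>, either \<open>z - a\<close> or its conjugate.\<close>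

lemma divide_out_zeros:
  fixes \<mu> :: "complex \<Rightarrow> complex \<Rightarrow> complex"
  assumes "finite Z" "Z \<subseteq> ball 0 1" "continuous_on (cball 0 1) W"
    and "{z \<in> cball 0 1. W z = 0} = Z"
    and "\<And>a. continuous_on UNIV (\<mu> a)" and "\<And>a z. \<mu> a z = 0 \<longleftrightarrow> z = a"
    and "\<And>a \<epsilon>. a \<in> Z \<Longrightarrow> \<epsilon> > 0 \<Longrightarrow> \<exists>\<delta> K. 0 < \<delta> \<and> \<delta> < \<epsilon> \<and> continuous_on (cball a \<delta>) K \<and>
           (\<forall>z\<in>cball a \<delta>. K z \<noteq> 0) \<and> (\<forall>z\<in>sphere a \<delta>. W z = \<mu> a z * K z)"
  shows "\<exists>K. continuous_on (cball 0 1) K \<and> (\<forall>z\<in>cball 0 1. K z \<noteq> 0) \<and>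
           (\<forall>z\<in>sphere 0 1. W z = (\<Prod>a\<in>Z. \<mu> a z) * K z)"
  using assms
proof (induction Z arbitrary: W rule: finite_induct)
  case empty
  then show ?case by (intro exI[of _ W]) auto
next
  case (insert a Z)
  note \<mu>c = insert.prems(4) and \<mu>0 = insert.prems(5) and loc = insert.prems(6)
  have a: "cmod a < 1" and "a \<notin> Z" using insert by auto
  obtain e where e: "e > 0" "\<And>b. b \<in> Z \<Longrightarrow> e \<le> dist a b"
    using finite_set_avoid[OF insert.hyps(1), of a] \<open>a \<notin> Z\<close> by metis
  \<comment> \<open>The first bound keeps the other zeros out of the small disc, the second keeps
    that disc inside the open unit disc, so that nothing changes on the circle.\<close>
  obtain \<delta> K where K: "0 < \<delta>" "\<delta> < min (e / 2) (1 - cmod a)" "continuous_on (cball a \<delta>) K"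
    "\<And>z. z \<in> cball a \<delta> \<Longrightarrow> K z \<noteq> 0" "\<And>z. z \<in> sphere a \<delta> \<Longrightarrow> W z = \<mu> a z * K z"
    using loc[of a "min (e / 2) (1 - cmod a)"] a e by (auto simp del: mem_cball mem_sphere)
  \<comment> \<open>Outside the small disc the factor is divided out, inside the zero is overwritten
    by \<open>K\<close>; the two pieces agree on \<open>sphere a \<delta>\<close>, so
    \<open>V\<close> is continuous and has lost exactly the zero \<open>a\<close>.\<close>
  define V where "V z = (if z \<in> cball a \<delta> then K z else W z / \<mu> a z)" for z
  have \<mu>c': "continuous_on S (\<mu> b)" for S b using \<mu>c continuous_on_subset by blast
  have V_far: "V z = W z / \<mu> a z" if "dist a z \<ge> \<delta>" for z
    using that K(1) K(5)[of z] \<mu>0[of a z] by (auto simp: V_def)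
  have contV: "continuous_on (cball 0 1) V"
  proof -
    have "continuous_on ((cball 0 1 \<inter> cball a \<delta>) \<union> (cball 0 1 - ball a \<delta>)) V"
    proof (rule continuous_on_closed_Un)
      show "continuous_on (cball 0 1 \<inter> cball a \<delta>) V"
        by (rule continuous_on_eq[of _ K]) (auto simp: V_def intro: continuous_on_subset[OF K(3)])
      show "continuous_on (cball 0 1 - ball a \<delta>) V"
      proof (rule continuous_on_eq[of _ "\<lambda>z. W z / \<mu> a z"])
        show "continuous_on (cball 0 1 - ball a \<delta>) (\<lambda>z. W z / \<mu> a z)"
          using K(1) by (intro continuous_intros continuous_on_subset[OF insert.prems(2)] \<mu>c') (auto simp: \<mu>0)
      qed (use V_far in auto)
    qed (auto intro: closed_Diff)
    moreover have "(cball 0 1 \<inter> cball a \<delta>) \<union> (cball 0 1 - ball a \<delta>) = cball 0 1" by auto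
    ultimately show ?thesis by simp
  qed
  have Z_far: "dist a b > \<delta>" if "b \<in> Z" for b
    using e(2)[OF that] e(1) K(2) by auto
  have V0: "{z \<in> cball 0 1. V z = 0} = Z"
  proof (intro set_eqI iffI)
    fix z assume z: "z \<in> {z \<in> cball 0 1. V z = 0}"
    then have "z \<notin> cball a \<delta>" using K(4) by (auto simp: V_def)
    then have "W z = 0" "z \<noteq> a" using z K(1) by (auto simp: V_def \<mu>0)
    then show "z \<in> Z" using insert.prems(3) z by auto
  next
    fix z assume z: "z \<in> Z"
    then have "z \<in> cball 0 1" "W z = 0" using insert.prems(3) by auto
    then show "z \<in> {z \<in> cball 0 1. V z = 0}" using V_far[of z] Z_far[OF z] by simp
  qed
  have "\<exists>K. continuous_on (cball 0 1) K \<and> (\<forall>z\<in>cball 0 1. K z \<noteq> 0) \<and>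
           (\<forall>z\<in>sphere 0 1. V z = (\<Prod>a\<in>Z. \<mu> a z) * K z)"
  proof (rule insert.IH[OF _ contV V0 \<mu>c \<mu>0])
    fix b' and \<epsilon> :: real assume b: "b' \<in> Z" "\<epsilon> > 0"
    \<comment> \<open>Discs of radius below \<open>\<epsilon>'\<close> around \<open>b'\<close> miss
      the disc around \<open>a\<close>; there \<open>V\<close> is still \<open>W / \<mu> a\<close>,
      and dividing by \<open>\<mu> a\<close> carries the local hypothesis over.\<close>
    define \<epsilon>' where "\<epsilon>' = min \<epsilon> (dist a b' - \<delta>)"
    have "\<epsilon>' > 0" using b Z_far by (auto simp: \<epsilon>'_def)
    then obtain \<delta>' K' where K': "0 < \<delta>'" "\<delta>' < \<epsilon>'" "continuous_on (cball b' \<delta>') K'"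
      "\<And>z. z \<in> cball b' \<delta>' \<Longrightarrow> K' z \<noteq> 0" "\<And>z. z \<in> sphere b' \<delta>' \<Longrightarrow> W z = \<mu> b' z * K' z"
      using loc[of b' \<epsilon>'] b by (auto simp del: mem_cball mem_sphere)
    have far: "dist a z > \<delta>" if "z \<in> cball b' \<delta>'" for z
    proof -
      have "dist b' z < dist a b' - \<delta>" using that K'(2) by (auto simp: \<epsilon>'_def)
      then show ?thesis using dist_triangle[of a b' z] by (simp add: dist_commute)
    qed
    have "\<And>z. z \<in> cball b' \<delta>' \<Longrightarrow> z \<noteq> a" using far K(1) by fastforce
    then show "\<exists>\<delta> K. 0 < \<delta> \<and> \<delta> < \<epsilon> \<and> continuous_on (cball b' \<delta>) K \<and>
           (\<forall>z\<in>cball b' \<delta>. K z \<noteq> 0) \<and> (\<forall>z\<in>sphere b' \<delta>. V z = \<mu> b' z * K z)"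
      using K' far V_far
      by (intro exI[of _ \<delta>'] exI[of _ "\<lambda>z. K' z / \<mu> a z"])
         (auto simp: \<mu>0 \<epsilon>'_def less_imp_le intro!: continuous_intros \<mu>c')
  qed (use insert.prems(1) in auto)
  then obtain K' where K': "continuous_on (cball 0 1) K'" "\<forall>z\<in>cball 0 1. K' z \<noteq> 0"
    "\<And>z. z \<in> sphere 0 1 \<Longrightarrow> V z = (\<Prod>a\<in>Z. \<mu> a z) * K' z" by blast
  have "W z = (\<Prod>a\<in>insert a Z. \<mu> a z) * K' z" if z: "z \<in> sphere 0 1" for z
  proof -
    have "1 \<le> cmod a + dist a z" using z norm_triangle_sub[of z a] by (auto simp: dist_norm norm_minus_commute)
    then have "dist a z > \<delta>" using K(2) by auto
    then have "V z = W z / \<mu> a z" "z \<noteq> a" using V_far K(1) by auto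
    then have "W z = \<mu> a z * V z" by (simp add: \<mu>0)
    then show ?thesis using K'(3)[OF z] insert.hyps by simp
  qed
  with K' show ?case by blast
qed

text \<open>Near \<open>a\<close> the quotient \<open>W / \<nu>\<close> stays within a distance less
  than \<open>cmod p\<close> of \<open>p\<close>. It need not have a limit at \<open>a\<close>, so
  it is contracted radially to the constant \<open>p\<close>; this keeps it away from 0 and leaves
  it unchanged on the bounding circle.\<close>

lemma local_factor:
  fixes W \<nu> :: "complex \<Rightarrow> complex"
  assumes W: "(W has_derivative L) (at a)" "W a = 0" and cont: "continuous_on (ball a r) W" "r > 0"
    and \<nu>: "continuous_on UNIV \<nu>" "\<And>z. cmod (\<nu> z) = cmod (z - a)"
    and L: "\<And>h. cmod (L h - p * \<nu> (a + h)) \<le> c * cmod h" and c: "c < cmod p"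
    and "\<epsilon> > 0"
  shows "\<exists>\<delta> K. 0 < \<delta> \<and> \<delta> < \<epsilon> \<and> continuous_on (cball a \<delta>) K \<and>
           (\<forall>z\<in>cball a \<delta>. K z \<noteq> 0) \<and> (\<forall>z\<in>sphere a \<delta>. W z = \<nu> z * K z)"
proof -
  \<comment> \<open>The midpoint: the gap \<open>c' - c\<close> absorbs the error of the linear
    approximation, and \<open>c' < cmod p\<close> still excludes zeros.\<close>
  define c' where "c' = (c + cmod p) / 2"
  have c': "c < c'" "c' < cmod p" using c by (auto simp: c'_def)
  obtain d where d: "d > 0" "\<And>z. cmod (z - a) < d \<Longrightarrow> cmod (W z - L (z - a)) \<le> (c' - c) * cmod (z - a)"
  proof -
    have "\<exists>d>0. \<forall>z. norm (z - a) < d \<longrightarrow> norm (W z - W a - L (z - a)) \<le> (c' - c) * norm (z - a)"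
      using W(1) c'(1) unfolding has_derivative_at_alt by auto
    then show ?thesis using that W(2) by auto
  qed
  have near: "cmod (W z - p * \<nu> z) \<le> c' * cmod (z - a)" if "cmod (z - a) < d" for z
  proof -
    have "cmod (W z - p * \<nu> z) \<le> cmod (W z - L (z - a)) + cmod (L (z - a) - p * \<nu> z)"
      by (metis diff_add_cancel add_diff_eq norm_triangle_ineq)
    also have "\<dots> \<le> (c' - c) * cmod (z - a) + c * cmod (z - a)"
      using d(2)[OF that] L[of "z - a"] by simp
    finally show ?thesis by (simp add: algebra_simps)
  qed
  define \<delta> where "\<delta> = min (min \<epsilon> d) r / 2"
  have \<delta>: "0 < \<delta>" "\<delta> < \<epsilon>" "\<delta> < d" "\<delta> < r" using d(1) \<open>\<epsilon> > 0\<close> cont(2) by (auto simp: \<delta>_def min_def)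
  \<comment> \<open>A segment from \<open>p\<close> at the centre to \<open>W z / \<nu> z\<close> at
    distance \<open>\<delta>\<close>. Division by 0 at \<open>a\<close> is harmless, since its
    coefficient vanishes there.\<close>
  define K where "K z = p + of_real (cmod (z - a) / \<delta>) * ((W z - p * \<nu> z) / \<nu> z)" for z
  have \<nu>0: "\<nu> z = 0 \<longleftrightarrow> z = a" for z using \<nu>(2)[of z] by (metis norm_eq_zero right_minus_eq)
  have quot: "cmod ((W z - p * \<nu> z) / \<nu> z) \<le> c'" if "z \<in> cball a \<delta>" "z \<noteq> a" for z
    using near[of z] that \<delta>(3) by (simp add: norm_divide \<nu>(2) dist_norm norm_minus_commute divide_le_eq)
  have K_near: "cmod (K z - p) \<le> cmod (z - a) / \<delta> * c'" if "z \<in> cball a \<delta>" for z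
  proof (cases "z = a")
    case False
    have "cmod (K z - p) = cmod (z - a) / \<delta> * cmod ((W z - p * \<nu> z) / \<nu> z)"
      unfolding K_def add_diff_cancel_left' norm_mult norm_of_real using \<delta>(1) by simp
    also have "\<dots> \<le> cmod (z - a) / \<delta> * c'" using quot[OF that False] \<delta>(1) by (intro mult_left_mono) auto
    finally show ?thesis .
  qed (simp add: K_def)
  have "0 \<le> c * 1" using L[of 1] norm_ge_zero order_trans by (metis norm_one)
  then have c'0: "0 \<le> c'" using c'(1) by simp
  have K0: "K z \<noteq> 0" if "z \<in> cball a \<delta>" for z
  proof
    assume "K z = 0"
    then have "cmod p \<le> cmod (z - a) / \<delta> * c'" using K_near[OF that] by simp
    also have "\<dots> \<le> 1 * c'" using that \<delta>(1) c'0
      by (intro mult_right_mono) (auto simp: dist_norm norm_minus_commute)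
    finally show False using c'(2) by simp
  qed
  have contK: "continuous_on (cball a \<delta>) K"
    unfolding continuous_on_eq_continuous_within
  proof
    fix z assume z: "z \<in> cball a \<delta>"
    show "continuous (at z within cball a \<delta>) K"
    proof (cases "z = a")
      case False
      have cW: "isCont W z"
        using cont(1) z \<delta>(4) by (auto simp: continuous_on_eq_continuous_at)
      have "isCont \<nu> z" using \<nu>(1) by (auto simp: continuous_on_eq_continuous_at)
      then have "isCont K z"
        unfolding K_def using cW False \<delta>(1) \<nu>0 by (auto intro!: continuous_intros)
      then show ?thesis by (rule continuous_at_imp_continuous_within)
    next
      case True
      have "((\<lambda>z. K z - p) \<longlongrightarrow> 0) (at a within cball a \<delta>)"
      proof (rule Lim_null_comparison)
        show "\<forall>\<^sub>F z in at a within cball a \<delta>. norm (K z - p) \<le> cmod (z - a) / \<delta> * c'"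
          unfolding eventually_at_filter by (rule always_eventually) (use K_near in blast)
        show "((\<lambda>z. cmod (z - a) / \<delta> * c') \<longlongrightarrow> 0) (at a within cball a \<delta>)"
          using \<delta>(1) by (auto intro!: tendsto_eq_intros)
      qed
      then have "(K \<longlongrightarrow> p) (at a within cball a \<delta>)" by (simp add: LIM_zero_iff)
      then show ?thesis using True by (simp add: continuous_within K_def)
    qed
  qed
  have "W z = \<nu> z * K z" if "z \<in> sphere a \<delta>" for z
  proof -
    have "cmod (z - a) = \<delta>" using that by (auto simp: dist_norm norm_minus_commute)
    moreover have "\<nu> z \<noteq> 0" using calculation \<delta>(1) by (auto simp: \<nu>0)
    ultimately show ?thesis using \<delta>(1) by (simp add: K_def field_simps)
  qed
  with \<delta> contK K0 show ?thesis by blast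
qed

text \<open>Poincare--Hopf for the projective plane, seen as the closed disc with antipodal boundary points
  identified.\<close>

lemma index_sum_eq_one:
  fixes W :: "complex \<Rightarrow> complex"
  assumes cont: "continuous_on UNIV W"
    and zeros: "{z \<in> cball 0 1. W z = 0} = P \<union> N" "finite (P \<union> N)" "P \<inter> N = {}" "P \<union> N \<subseteq> ball 0 1"
    and P: "\<And>a. a \<in> P \<Longrightarrow> \<exists>p q. cmod q < cmod p \<and> (W has_derivative (\<lambda>h. p * h + q * cnj h)) (at a)"
    and N: "\<And>a. a \<in> N \<Longrightarrow> \<exists>p q. cmod p < cmod q \<and> (W has_derivative (\<lambda>h. p * h + q * cnj h)) (at a)"
    and anti: "\<And>z. cmod z = 1 \<Longrightarrow> W (- z) * cnj (- z) = - cnj (W z * cnj z)"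
  shows "int (card P) - int (card N) = 1"
proof -
  define \<mu> where "\<mu> a z = (if a \<in> P then z - a else cnj (z - a))" for a z
  have "\<exists>K. continuous_on (cball 0 1) K \<and> (\<forall>z\<in>cball 0 1. K z \<noteq> 0) \<and>
           (\<forall>z\<in>sphere 0 1. W z = (\<Prod>a\<in>P \<union> N. \<mu> a z) * K z)"
  proof (rule divide_out_zeros[OF zeros(2,4) _ zeros(1)])
    show "continuous_on (cball 0 1) W" using cont continuous_on_subset by blast
    show \<mu>c: "continuous_on UNIV (\<mu> a)" for a
      unfolding \<mu>_def by (cases "a \<in> P") (auto intro!: continuous_intros)
    show "\<mu> a z = 0 \<longleftrightarrow> z = a" for a z by (auto simp: \<mu>_def)
    fix a and \<epsilon> :: real assume a: "a \<in> P \<union> N" and \<epsilon>: "\<epsilon> > 0"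
    have W0: "W a = 0" using zeros(1) a by blast
    have cW: "continuous_on (ball a 1) W" using cont continuous_on_subset by blast
    have \<mu>n: "cmod (\<mu> a z) = cmod (z - a)" for z
      by (simp only: \<mu>_def complex_mod_cnj if_cancel split: if_split) simp
    show "\<exists>\<delta> K. 0 < \<delta> \<and> \<delta> < \<epsilon> \<and> continuous_on (cball a \<delta>) K \<and>
           (\<forall>z\<in>cball a \<delta>. K z \<noteq> 0) \<and> (\<forall>z\<in>sphere a \<delta>. W z = \<mu> a z * K z)"
    proof (cases "a \<in> P")
      case True
      then obtain p q where pq: "cmod q < cmod p" "(W has_derivative (\<lambda>h. p * h + q * cnj h)) (at a)"
        using P by blast
      show ?thesis
        by (rule local_factor[OF pq(2) W0 cW _ \<mu>c \<mu>n _ pq(1) \<epsilon>]) (use True in \<open>auto simp: \<mu>_def norm_mult\<close>)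
    next
      case False
      then obtain p q where pq: "cmod p < cmod q" "(W has_derivative (\<lambda>h. p * h + q * cnj h)) (at a)"
        using N a by blast
      show ?thesis
        by (rule local_factor[OF pq(2) W0 cW _ \<mu>c \<mu>n _ pq(1) \<epsilon>]) (use False in \<open>auto simp: \<mu>_def norm_mult\<close>)
    qed
  qed
  then obtain K where K: "continuous_on (cball 0 1) K" "\<And>z. z \<in> cball 0 1 \<Longrightarrow> K z \<noteq> 0"
    "\<And>z. cmod z = 1 \<Longrightarrow> W z = (\<Prod>a\<in>P \<union> N. \<mu> a z) * K z" by auto
  obtain k where k: "continuous_on (cball 0 1) k" "\<And>z. z \<in> cball 0 1 \<Longrightarrow> K z = exp (k z)"
    using continuous_logarithm_on_cball[OF K(1,2)] by metis
  \<comment> \<open>For \<open>cmod z = 1\<close> and \<open>cmod a < 1\<close> the number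
    \<open>1 - a * cnj z\<close> has positive real part, so the principal logarithm is continuous on
    the circle.\<close>
  define l where "l a z = Ln (1 - a * cnj z)" for a z
  have half: "1 - a * cnj z \<notin> \<real>\<^sub>\<le>\<^sub>0" if "cmod z = 1" "a \<in> P \<union> N" for a z
  proof -
    have "cmod (a * cnj z) < 1" using that zeros(4) by (auto simp: norm_mult)
    then have "Re (a * cnj z) < 1" using complex_Re_le_cmod le_less_trans by blast
    then show ?thesis by (auto simp: complex_nonpos_Reals_iff)
  qed
  have l: "exp (l a z) = 1 - a * cnj z" if "cmod z = 1" "a \<in> P \<union> N" for a z
    unfolding l_def using half[OF that] by (intro exp_Ln) auto
  have factor: "z * (1 - a * cnj z) = z - a" if "cmod z = 1" for a z
    using that complex_norm_square[of z] by (simp add: algebra_simps)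
  define L where "L z = (\<Sum>a\<in>P. l a z) + (\<Sum>a\<in>N. cnj (l a z)) + k z" for z
  have "W z = z ^ card P * cnj z ^ card N * exp (L z)" if z: "cmod z = 1" for z
  proof -
    have "(\<Prod>a\<in>P. \<mu> a z) = (\<Prod>a\<in>P. z * exp (l a z))"
      by (rule prod.cong) (auto simp: \<mu>_def l[OF z] factor[OF z])
    moreover have "(\<Prod>a\<in>N. \<mu> a z) = (\<Prod>a\<in>N. cnj (z * exp (l a z)))"
      by (rule prod.cong) (use zeros(3) in \<open>auto simp: \<mu>_def l[OF z] factor[OF z] simp del: complex_cnj_mult complex_cnj_diff\<close>)
    moreover have "(\<Prod>a\<in>P \<union> N. \<mu> a z) = (\<Prod>a\<in>P. \<mu> a z) * (\<Prod>a\<in>N. \<mu> a z)"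
      using zeros by (intro prod.union_disjoint) auto
    ultimately show ?thesis
      using K(3)[OF z] k(2)[of z] z zeros(2)
      by (simp add: L_def exp_add exp_sum prod.distrib exp_cnj)
  qed
  moreover have "continuous_on (sphere 0 1) L"
  proof -
    have "continuous_on (sphere 0 1) (l a)" if "a \<in> P \<union> N" for a
      unfolding l_def using half that by (auto intro!: continuous_intros)
    moreover have "continuous_on (sphere 0 1) k"
      using k(1) by (rule continuous_on_subset) auto
    ultimately show ?thesis unfolding L_def by (auto intro!: continuous_intros)
  qed
  ultimately show ?thesis
    using index_from_antipodal_symmetry[of L W "card P" "card N"] anti by blast
qed

text \<open>Infinitely many zeros would accumulate at a zero \<open>a\<close> by compactness. But
  the derivative at \<open>a\<close> stretches every \<open>h\<close> by at least
  \<open>\<bar>cmod p - cmod q\<bar>\<close>, so \<open>a\<close> is isolated.\<close>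

lemma nondegenerate_zeros_finite:
  fixes W :: "complex \<Rightarrow> complex"
  assumes "continuous_on UNIV W"
    and der: "\<And>a. W a = 0 \<Longrightarrow> \<exists>p q. cmod p \<noteq> cmod q \<and> (W has_derivative (\<lambda>h. p * h + q * cnj h)) (at a)"
  shows "finite {z \<in> cball 0 1. W z = 0}"
proof (rule ccontr)
  define Z where "Z = {z \<in> cball 0 1. W z = 0}"
  assume "infinite {z \<in> cball 0 1. W z = 0}"
  moreover have "closed {z. W z = 0}"
    using continuous_closed_preimage_constant[OF assms(1) closed_UNIV, of 0] by simp
  then have "compact Z"
    using compact_Int_closed[OF compact_cball, of "{z. W z = 0}" 0 1] by (simp add: Z_def Int_def)
  ultimately obtain a where a: "a \<in> Z" "a islimpt Z"
    unfolding compact_eq_Bolzano_Weierstrass Z_def by blast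
  then have W0: "W a = 0" by (simp add: Z_def)
  obtain p q where pq: "cmod p \<noteq> cmod q" "(W has_derivative (\<lambda>h. p * h + q * cnj h)) (at a)"
    using der[OF W0] by blast
  define e where "e = \<bar>cmod p - cmod q\<bar> / 2"
  have "e > 0" using pq(1) by (simp add: e_def)
  then obtain d where d: "d > 0" and
    *: "\<And>z. cmod (z - a) < d \<Longrightarrow> cmod (W z - W a - (p * (z - a) + q * cnj (z - a))) \<le> e * cmod (z - a)"
    using pq(2) unfolding has_derivative_at_alt by meson
  obtain z where z: "z \<in> Z" "z \<noteq> a" "dist z a < d"
    using a(2) d unfolding islimpt_approachable by blast
  have Wz: "W z = 0" using z(1) by (simp add: Z_def)
  have "\<bar>cmod p - cmod q\<bar> * cmod (z - a) = \<bar>cmod (p * (z - a)) - cmod (q * cnj (z - a))\<bar>"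
    by (simp only: norm_mult complex_mod_cnj left_diff_distrib[symmetric] abs_mult) simp
  also have "\<dots> \<le> cmod (p * (z - a) + q * cnj (z - a))"
    using norm_triangle_ineq3[of "p * (z - a)" "- (q * cnj (z - a))"] by simp
  also have "\<dots> = cmod (W z - W a - (p * (z - a) + q * cnj (z - a)))"
    unfolding W0 Wz diff_self diff_0 norm_minus_cancel ..
  also have "\<dots> \<le> e * cmod (z - a)"
    using *[of z] z(3) by (simp add: dist_norm)
  also have "\<dots> < \<bar>cmod p - cmod q\<bar> * cmod (z - a)"
    using z(2) pq(1) by (simp add: e_def)
  finally show False by simp
qed

section \<open>Real ternary forms\<close>

text \<open>Counterparts of \<open>mono\<close>, \<open>heval\<close>, \<open>hgrad\<close> and
  \<open>hhess\<close> on real vectors, where they can be identified as actual derivatives.\<close>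

definition rmono :: "real^3 \<Rightarrow> nat^3 \<Rightarrow> real" where
  "rmono u e = (\<Prod>m\<in>UNIV. (u$m) ^ (e$m))"

definition form :: "nat \<Rightarrow> (nat^3 \<Rightarrow> real) \<Rightarrow> real^3 \<Rightarrow> real" where
  "form d c u = (\<Sum>e\<in>degd d. c e * rmono u e)"

definition form_grad :: "nat \<Rightarrow> (nat^3 \<Rightarrow> real) \<Rightarrow> real^3 \<Rightarrow> real^3" where
  "form_grad d c u = (\<chi> k. \<Sum>e\<in>degd d. c e * real (e$k) * rmono u (dexp k e))"

definition form_hess :: "nat \<Rightarrow> (nat^3 \<Rightarrow> real) \<Rightarrow> real^3 \<Rightarrow> real^3^3" where
  "form_hess d c u = (\<chi> k l. \<Sum>e\<in>degd d. c e * real (e$k) * real ((dexp k e)$l)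
                                    * rmono u (dexp l (dexp k e)))"

lemma prod_UNIV_3: "prod f (UNIV :: 3 set) = f 1 * f 2 * (f 3 :: 'a :: comm_monoid_mult)"
  unfolding UNIV_3 by (simp add: ac_simps)

lemma rmono_has_derivative:
  "((\<lambda>u. rmono u e) has_derivative (\<lambda>h. \<Sum>k\<in>UNIV. real (e$k) * rmono u (dexp k e) * h$k)) (at u)"
  unfolding rmono_def prod_UNIV_3 sum_3 dexp_def
  by (auto intro!: derivative_eq_intros bounded_linear_imp_has_derivative[OF bounded_linear_vec_nth]
      simp: algebra_simps)

lemma rmono_euler: "(\<Sum>k\<in>UNIV. real (e$k) * rmono u (dexp k e) * u$k) = real (\<Sum>k\<in>UNIV. e$k) * rmono u e"
proof -
  have "real (e$k) * rmono u (dexp k e) * u$k = real (e$k) * rmono u e" for k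
    using exhaust_3[of k]
    by (cases "e$k") (auto simp: rmono_def dexp_def prod_UNIV_3)
  then show ?thesis by (simp only: of_nat_sum sum_distrib_right)
qed

lemma rmono_scale: "rmono (t *\<^sub>R u) e = t ^ (\<Sum>k\<in>UNIV. e$k) * rmono u e"
  by (simp add: rmono_def prod_UNIV_3 sum_3 power_mult_distrib power_add)

lemma sum_dexp: "e$k > 0 \<Longrightarrow> (\<Sum>l\<in>UNIV. dexp k e $ l) = (\<Sum>l\<in>UNIV. e$l) - 1"
  using exhaust_3[of k] by (auto simp: dexp_def sum_3)

lemma form_has_derivative: "(form d c has_derivative (\<lambda>h. form_grad d c u \<bullet> h)) (at u)"
proof -
  have "(form d c has_derivative (\<lambda>h. \<Sum>e\<in>degd d. c e * (\<Sum>k\<in>UNIV. real (e$k) * rmono u (dexp k e) * h$k))) (at u)"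
    unfolding form_def[abs_def] by (intro has_derivative_sum has_derivative_mult_right rmono_has_derivative)
  moreover have "(\<lambda>h. \<Sum>e\<in>degd d. c e * (\<Sum>k\<in>UNIV. real (e$k) * rmono u (dexp k e) * h$k)) = (\<lambda>h. form_grad d c u \<bullet> h)"
    by (simp add: form_grad_def inner_vec_def sum_distrib_left sum_distrib_right mult.assoc sum.swap[of _ UNIV "degd d"])
  ultimately show ?thesis by simp
qed

lemma form_grad_has_derivative: "(form_grad d c has_derivative (\<lambda>h. form_hess d c u *v h)) (at u)"
proof (rule has_derivative_componentwise_within[THEN iffD2], intro ballI)
  fix i :: "real^3" assume "i \<in> Basis"
  then obtain k where i: "i = axis k 1" by (auto simp: Basis_vec_def)
  have "((\<lambda>u. \<Sum>e\<in>degd d. c e * real (e$k) * rmono u (dexp k e)) has_derivative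
     (\<lambda>h. \<Sum>e\<in>degd d. c e * real (e$k) * (\<Sum>l\<in>UNIV. real (dexp k e$l) * rmono u (dexp l (dexp k e)) * h$l))) (at u)"
    by (intro has_derivative_sum has_derivative_mult_right rmono_has_derivative)
  moreover have "(\<lambda>h. \<Sum>e\<in>degd d. c e * real (e$k) * (\<Sum>l\<in>UNIV. real (dexp k e$l) * rmono u (dexp l (dexp k e)) * h$l))
     = (\<lambda>h. (form_hess d c u *v h) \<bullet> i)"
    by (simp add: i form_hess_def inner_axis matrix_vector_mult_def sum_distrib_left sum_distrib_right mult.assoc
        sum.swap[of _ UNIV "degd d"])
  ultimately show "((\<lambda>x. form_grad d c x \<bullet> i) has_derivative (\<lambda>h. (form_hess d c u *v h) \<bullet> i)) (at u)"
    by (simp add: i form_grad_def inner_axis)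
qed

lemma form_euler: "form_grad d c u \<bullet> u = real d * form d c u"
proof -
  have "form_grad d c u \<bullet> u = (\<Sum>e\<in>degd d. c e * (\<Sum>k\<in>UNIV. real (e$k) * rmono u (dexp k e) * u$k))"
    by (simp add: form_grad_def inner_vec_def sum_distrib_left sum_distrib_right mult.assoc sum.swap[of _ UNIV "degd d"])
  also have "\<dots> = (\<Sum>e\<in>degd d. c e * (real d * rmono u e))"
    unfolding rmono_euler by (rule sum.cong) (auto simp: degd_def)
  finally show ?thesis by (simp add: form_def sum_distrib_left algebra_simps)
qed

lemma form_grad_euler: "form_hess d c u *v u = real (d - 1) *\<^sub>R form_grad d c u"
proof (intro vec_eq_iff[THEN iffD2] allI)
  fix k
  have "(form_hess d c u *v u) $ k =
     (\<Sum>e\<in>degd d. c e * real (e$k) * (\<Sum>l\<in>UNIV. real (dexp k e$l) * rmono u (dexp l (dexp k e)) * u$l))"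
    by (simp add: form_hess_def matrix_vector_mult_def sum_distrib_left sum_distrib_right mult.assoc
        sum.swap[of _ UNIV "degd d"])
  also have "\<dots> = (\<Sum>e\<in>degd d. c e * real (e$k) * (real (d - 1) * rmono u (dexp k e)))"
    unfolding rmono_euler
  proof (rule sum.cong[OF refl])
    \<comment> \<open>If \<open>e$k = 0\<close>, truncated subtraction leaves
      \<open>dexp k e\<close> with degree \<open>d\<close> instead of \<open>d - 1\<close>, but then
      the coefficient is 0.\<close>
    fix e assume "e \<in> degd d"
    then show "c e * real (e$k) * (real (\<Sum>l\<in>UNIV. dexp k e $ l) * rmono u (dexp k e))
        = c e * real (e$k) * (real (d - 1) * rmono u (dexp k e))"
      using sum_dexp[of e k] by (cases "e$k = 0") (auto simp: degd_def)
  qed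
  finally show "(form_hess d c u *v u) $ k = (real (d - 1) *\<^sub>R form_grad d c u) $ k"
    by (simp add: form_grad_def sum_distrib_left algebra_simps)
qed

lemma form_hess_sym: "form_hess d c u $ k $ l = form_hess d c u $ l $ k"
proof -
  have "dexp l (dexp k e) = dexp k (dexp l e)" for e by (simp add: dexp_def vec_eq_iff)
  moreover have "real (e$k) * real (dexp k e $ l) = real (e$l) * real (dexp l e $ k)" for e :: "nat^3"
    by (simp add: dexp_def)
  ultimately show ?thesis by (simp add: form_hess_def mult.assoc) (simp add: mult.assoc[symmetric])
qed

lemma form_scale: "form d c (t *\<^sub>R u) = t ^ d * form d c u"
  by (simp add: form_def rmono_scale sum_distrib_left degd_def algebra_simps)

lemma form_grad_scale: "form_grad d c (t *\<^sub>R u) = t ^ (d - 1) *\<^sub>R form_grad d c u"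
proof -
  have "c e * real (e$k) * rmono (t *\<^sub>R u) (dexp k e) = t ^ (d - 1) * (c e * real (e$k) * rmono u (dexp k e))"
    if "e \<in> degd d" for e k
    using that sum_dexp[of e k] by (cases "e$k = 0") (auto simp: rmono_scale degd_def)
  then show ?thesis
    by (auto simp: form_grad_def vec_eq_iff sum_distrib_left intro!: sum.cong)
qed

lemma form_hess_scale: "form_hess d c (t *\<^sub>R u) = t ^ (d - 2) *\<^sub>R form_hess d c u"
proof -
  have "c e * real (e$k) * real (dexp k e$l) * rmono (t *\<^sub>R u) (dexp l (dexp k e))
      = t ^ (d - 2) * (c e * real (e$k) * real (dexp k e$l) * rmono u (dexp l (dexp k e)))"
    if "e \<in> degd d" for e k l
    using that sum_dexp[of e k] sum_dexp[of "dexp k e" l]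
    by (cases "e$k = 0"; cases "dexp k e$l = 0") (auto simp: rmono_scale degd_def diff_diff_left numeral_2_eq_2)
  then show ?thesis
    by (auto simp: form_hess_def vec_eq_iff sum_distrib_left intro!: sum.cong)
qed

lemma form_lincomb:
  "form d (\<lambda>e. a * F e + b * G e) u = a * form d F u + b * form d G u"
  "form_grad d (\<lambda>e. a * F e + b * G e) u = a *\<^sub>R form_grad d F u + b *\<^sub>R form_grad d G u"
  by (simp_all add: form_def form_grad_def vec_eq_iff sum_distrib_left sum.distrib[symmetric] algebra_simps)

section \<open>Real forms against the complex evaluations\<close>

lemma mono_cvec: "mono (cvec u) e = of_real (rmono u e)"
  by (simp add: mono_def rmono_def cvec_def)

lemma heval_cvec: "heval d (\<lambda>e. of_real (c e)) (cvec u) = of_real (form d c u)"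
  by (simp add: heval_def form_def mono_cvec)

lemma hgrad_cvec: "hgrad d (\<lambda>e. of_real (c e)) k (cvec u) = of_real (form_grad d c u $ k)"
  by (simp add: hgrad_def form_grad_def mono_cvec)

lemma hhess_cvec: "hhess d (\<lambda>e. of_real (c e)) k l (cvec u) = of_real (form_hess d c u $ k $ l)"
  by (simp add: hhess_def form_hess_def mono_cvec)

lemma tcone_cvec: "tcone d (\<lambda>e. of_real (c e)) (cvec u) w = w \<bullet> (form_hess d c u *v w)"
  by (simp add: tcone_def hhess_cvec inner_vec_def matrix_vector_mult_def sum_distrib_left algebra_simps)

lemma cvec_eq_0 [simp]: "cvec u = 0 \<longleftrightarrow> u = 0"
  by (simp add: cvec_def vec_eq_iff)

lemma cvec_scaleR: "cvec (t *\<^sub>R u) = of_real t *s cvec u"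
  by (simp add: cvec_def vec_eq_iff)

lemma realvec_cvec [simp]: "realvec (cvec u)"
  by (simp add: realvec_def cvec_def)

lemma realvec_imp_cvec: "realvec v \<Longrightarrow> \<exists>u. v = cvec u"
  unfolding realvec_def cvec_def
  by (rule exI[of _ "\<chi> m. Re (v$m)"]) (simp add: vec_eq_iff)

lemma cvec_multiple_real:
  assumes "cvec u = a *s cvec w" "w \<noteq> 0"
  shows "u = Re a *\<^sub>R w"
proof -
  have "of_real (u$m) = a * of_real (w$m)" for m
    using assms(1) by (simp add: cvec_def vec_eq_iff)
  then have "Re (of_real (u$m)) = Re (a * of_real (w$m))" for m by metis
  then show ?thesis by (simp add: vec_eq_iff)
qed

text \<open>By Euler's identity a vanishing gradient already forces the form to vanish, as the
  degree is positive.\<close>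

lemma singular_pt_cvec:
  assumes "d \<ge> 1"
  shows "singular_pt d (\<lambda>e. of_real (c e)) (cvec u) \<longleftrightarrow> u \<noteq> 0 \<and> form_grad d c u = 0"
proof -
  have "form_grad d c u = 0 \<Longrightarrow> form d c u = 0" using form_euler[of d c u] assms by simp
  then show ?thesis by (auto simp: singular_pt_def heval_cvec hgrad_cvec vec_eq_iff[of "form_grad d c u"])
qed

lemma rmem_eq: "rmem F G \<theta> = (\<lambda>e. of_real (cos \<theta> * F e + sin \<theta> * G e))"
  by (simp add: rmem_def pmem_def)

section \<open>The vector field of a pencil in a stereographic chart\<close>

text \<open>The derivative of \<open>G/F\<close>, cleared of denominators.\<close>

definition pencil_field :: "nat \<Rightarrow> (nat^3 \<Rightarrow> real) \<Rightarrow> (nat^3 \<Rightarrow> real) \<Rightarrow> real^3 \<Rightarrow> real^3" where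
  "pencil_field d F G u = form d F u *\<^sub>R form_grad d G u - form d G u *\<^sub>R form_grad d F u"

lemma pencil_field_has_derivative:
  "(pencil_field d F G has_derivative
     (\<lambda>h. form d F u *\<^sub>R (form_hess d G u *v h) + (form_grad d F u \<bullet> h) *\<^sub>R form_grad d G u
       - (form d G u *\<^sub>R (form_hess d F u *v h) + (form_grad d G u \<bullet> h) *\<^sub>R form_grad d F u))) (at u)"
  unfolding pencil_field_def[abs_def]
  by (intro has_derivative_diff has_derivative_scaleR form_has_derivative form_grad_has_derivative)

lemma pencil_field_scale: "pencil_field d F G (t *\<^sub>R u) = t ^ (d + (d - 1)) *\<^sub>R pencil_field d F G u"
  by (simp add: pencil_field_def form_scale form_grad_scale power_add algebra_simps)

text \<open>A change of generators multiplies the field by its determinant, which is 1 for a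
  rotation. Any chosen member may thus be taken as the first generator.\<close>

lemma pencil_field_rotate:
  "pencil_field d (\<lambda>e. cos \<theta> * F e + sin \<theta> * G e) (\<lambda>e. - sin \<theta> * F e + cos \<theta> * G e) = pencil_field d F G"
proof
  fix u
  let ?f = "form d F u" and ?g = "form d G u"
  let ?f' = "form_grad d F u" and ?g' = "form_grad d G u"
  let ?c = "cos \<theta>" and ?s = "sin \<theta>"
  have "(?c * ?f + ?s * ?g) * (- ?s * x + ?c * y) - (- ?s * ?f + ?c * ?g) * (?c * x + ?s * y)
      = (?c\<^sup>2 + ?s\<^sup>2) * (?f * y - ?g * x)" for x y
    by algebra
  then show "pencil_field d (\<lambda>e. ?c * F e + ?s * G e) (\<lambda>e. - ?s * F e + ?c * G e) u = pencil_field d F G u"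
    unfolding pencil_field_def form_lincomb vec_eq_iff by simp
qed

text \<open>By Euler both terms contribute \<open>d * F * G\<close>. Hence the field is known from
  its products with two vectors that complete \<open>u\<close> to a basis.\<close>

lemma pencil_field_orthogonal: "pencil_field d F G u \<bullet> u = 0"
  by (simp add: pencil_field_def inner_diff_left form_euler)

text \<open>Inverse stereographic projection, followed by the linear map \<open>e\<^sub>1 \<mapsto> (-a,1,0)\<close>, \<open>e\<^sub>2 \<mapsto> (-b,0,1)\<close>,
  \<open>e\<^sub>3 \<mapsto> (1,0,0)\<close>. Up to scaling, the closed unit disc covers the projective plane, and
  the unit circle goes to the line with normal vector \<open>(1,a,b)\<close>.\<close>

definition chart :: "real \<Rightarrow> real \<Rightarrow> complex \<Rightarrow> real^3" where
  "chart a b z = vector [1 - (Re z)\<^sup>2 - (Im z)\<^sup>2 - 2 * a * Re z - 2 * b * Im z, 2 * Re z, 2 * Im z]"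

text \<open>The partial derivative of \<open>chart\<close> in \<open>Re z\<close>, free of
  \<open>b\<close>; likewise \<open>chart_y\<close> in \<open>Im z\<close>, free of
  \<open>a\<close>. Together with \<open>chart a b z\<close> they form a basis of the space.\<close>

definition chart_x :: "real \<Rightarrow> complex \<Rightarrow> real^3" where
  "chart_x a z = vector [- 2 * Re z - 2 * a, 2, 0]"

definition chart_y :: "real \<Rightarrow> complex \<Rightarrow> real^3" where
  "chart_y b z = vector [- 2 * Im z - 2 * b, 0, 2]"

lemma vector_3_conv_axis: "(vector [x, y, z] :: real^3) = x *\<^sub>R axis 1 1 + y *\<^sub>R axis 2 1 + z *\<^sub>R axis 3 1"
  by (simp add: vec_eq_iff forall_3 axis_def)

lemma has_derivative_vector_3:
  assumes "(f has_derivative f') F" "(g has_derivative g') F" "(h has_derivative h') F"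
  shows "((\<lambda>z. vector [f z, g z, h z] :: real^3) has_derivative (\<lambda>z. vector [f' z, g' z, h' z])) F"
  unfolding vector_3_conv_axis
  by (intro has_derivative_add has_derivative_scaleR_left assms)

lemmas has_derivative_Re_id = bounded_linear_imp_has_derivative[OF bounded_linear_Re]
lemmas has_derivative_Im_id = bounded_linear_imp_has_derivative[OF bounded_linear_Im]

lemma chart_has_derivative:
  "(chart a b has_derivative (\<lambda>h. Re h *\<^sub>R chart_x a z + Im h *\<^sub>R chart_y b z)) (at z)"
proof -
  have "(chart a b has_derivative (\<lambda>h. vector [- 2 * Re z * Re h - 2 * Im z * Im h - 2 * a * Re h - 2 * b * Im h,
      2 * Re h, 2 * Im h])) (at z)"
    unfolding chart_def[abs_def]
    by (rule has_derivative_vector_3)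
       (auto intro!: derivative_eq_intros has_derivative_Re_id has_derivative_Im_id simp: algebra_simps)
  then show ?thesis
    by (rule has_derivative_eq_rhs) (auto simp: vec_eq_iff forall_3 chart_x_def chart_y_def algebra_simps)
qed

lemma chart_x_has_derivative: "(chart_x a has_derivative (\<lambda>h. vector [- 2 * Re h, 0, 0])) (at z)"
  unfolding chart_x_def[abs_def]
  by (rule has_derivative_vector_3) (auto intro!: derivative_eq_intros has_derivative_Re_id)

lemma chart_y_has_derivative: "(chart_y b has_derivative (\<lambda>h. vector [- 2 * Im h, 0, 0])) (at z)"
  unfolding chart_y_def[abs_def]
  by (rule has_derivative_vector_3) (auto intro!: derivative_eq_intros has_derivative_Im_id)

lemma chart_frame_span: "\<exists>\<alpha> \<beta> \<gamma>. u = \<alpha> *\<^sub>R chart_x a z + \<beta> *\<^sub>R chart_y b z + \<gamma> *\<^sub>R chart a b z"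
proof -
  \<comment> \<open>Components 2 and 3 of the desired equation give the other two coefficients in
    terms of \<open>\<gamma>\<close>; substituted into component 1 they leave this value.\<close>
  define \<gamma> where "\<gamma> = (u$1 + a * u$2 + b * u$3 + Re z * u$2 + Im z * u$3) / (1 + (Re z)\<^sup>2 + (Im z)\<^sup>2)"
  have "1 + (Re z)\<^sup>2 + (Im z)\<^sup>2 > 0" by (simp add: add_pos_nonneg)
  then have \<gamma>: "\<gamma> * (1 + (Re z)\<^sup>2 + (Im z)\<^sup>2) = u$1 + a * u$2 + b * u$3 + Re z * u$2 + Im z * u$3"
    by (simp add: \<gamma>_def)
  show ?thesis
  proof (intro exI)
    show "u = (u$2 / 2 - Re z * \<gamma>) *\<^sub>R chart_x a z + (u$3 / 2 - Im z * \<gamma>) *\<^sub>R chart_y b z + \<gamma> *\<^sub>R chart a b z"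
      using \<gamma> by (simp add: vec_eq_iff forall_3 chart_x_def chart_y_def chart_def power2_eq_square field_simps)
  qed
qed

lemma chart_frame_independent:
  assumes "\<alpha> *\<^sub>R chart_x a z + \<beta> *\<^sub>R chart_y b z = \<gamma> *\<^sub>R chart a b z"
  shows "\<alpha> = 0" "\<beta> = 0"
proof -
  have eqs: "\<alpha> = \<gamma> * Re z" "\<beta> = \<gamma> * Im z"
    "\<alpha> * (- 2 * Re z - 2 * a) + \<beta> * (- 2 * Im z - 2 * b)
       = \<gamma> * (1 - (Re z)\<^sup>2 - (Im z)\<^sup>2 - 2 * a * Re z - 2 * b * Im z)"
    using assms by (auto simp: vec_eq_iff forall_3 chart_x_def chart_y_def chart_def)
  have "\<gamma> * (1 + (Re z)\<^sup>2 + (Im z)\<^sup>2) = 0"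
    using eqs(3) unfolding eqs(1,2) by (simp add: algebra_simps power2_eq_square)
  moreover have "1 + (Re z)\<^sup>2 + (Im z)\<^sup>2 > 0" by (simp add: add_pos_nonneg)
  ultimately have "\<gamma> = 0" by simp
  then show "\<alpha> = 0" "\<beta> = 0" using eqs by auto
qed

lemma chart_nonzero: "chart a b z \<noteq> 0"
  by (auto simp: chart_def vec_eq_iff forall_3)

lemma orthogonal_frame_zero:
  assumes "w \<bullet> chart_x a z = 0" "w \<bullet> chart_y b z = 0" "w \<bullet> chart a b z = 0"
  shows "w = 0"
proof -
  obtain \<alpha> \<beta> \<gamma> where w: "w = \<alpha> *\<^sub>R chart_x a z + \<beta> *\<^sub>R chart_y b z + \<gamma> *\<^sub>R chart a b z"
    using chart_frame_span by blast
  have "w \<bullet> w = \<alpha> * (w \<bullet> chart_x a z) + \<beta> * (w \<bullet> chart_y b z) + \<gamma> * (w \<bullet> chart a b z)"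
    by (subst (2) w) (simp add: inner_add_right)
  then show ?thesis using assms by simp
qed

definition line_coord :: "real \<Rightarrow> real \<Rightarrow> real^3 \<Rightarrow> real" where
  "line_coord a b u = u$1 + a * u$2 + b * u$3"

lemma line_coord_chart: "line_coord a b (chart a b z) = 1 - (cmod z)\<^sup>2"
  by (simp add: line_coord_def chart_def cmod_power2)

lemma line_coord_scale: "line_coord a b (t *\<^sub>R u) = t * line_coord a b u"
  by (simp add: line_coord_def algebra_simps)

lemma chart_surj_closed:
  assumes "u \<noteq> 0"
  shows "\<exists>z t. z \<in> cball 0 1 \<and> t \<noteq> 0 \<and> u = t *\<^sub>R chart a b z"
proof -
  have pos: "\<exists>z t. z \<in> cball 0 1 \<and> t \<noteq> 0 \<and> u = t *\<^sub>R chart a b z"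
    if u: "u \<noteq> 0" and \<gamma>: "line_coord a b u \<ge> 0" for u
  proof -
    \<comment> \<open>In the coordinates \<open>(u$2, u$3, c)\<close> the vector lies on a sphere of
      radius \<open>n\<close>, and \<open>z\<close> below is its stereographic projection from the
      south pole; \<open>c \<ge> 0\<close> means the upper hemisphere, hence the closed
      disc.\<close>
    define c n where "c = line_coord a b u" and "n = sqrt ((u$2)\<^sup>2 + (u$3)\<^sup>2 + c\<^sup>2)"
    have "u$2 \<noteq> 0 \<or> u$3 \<noteq> 0 \<or> c \<noteq> 0"
      using u by (auto simp: c_def line_coord_def vec_eq_iff forall_3)
    then have "(u$2)\<^sup>2 + (u$3)\<^sup>2 + c\<^sup>2 > 0"
      by (auto simp: less_le add_nonneg_eq_0_iff)
    then have n: "n > 0" "n\<^sup>2 = (u$2)\<^sup>2 + (u$3)\<^sup>2 + c\<^sup>2" by (auto simp: n_def)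
    have c0: "c \<ge> 0" using \<gamma> by (simp add: c_def)
    define z where "z = Complex (u$2 / (n + c)) (u$3 / (n + c))"
    have nc: "n + c > 0" using n c0 by simp
    have zz: "(Re z)\<^sup>2 + (Im z)\<^sup>2 = (n - c) / (n + c)"
    proof -
      have "(Re z)\<^sup>2 + (Im z)\<^sup>2 = ((u$2)\<^sup>2 + (u$3)\<^sup>2) / (n + c)\<^sup>2"
        by (simp add: z_def power_divide add_divide_distrib)
      also have "(u$2)\<^sup>2 + (u$3)\<^sup>2 = (n - c) * (n + c)" using n(2) by (simp add: algebra_simps power2_eq_square)
      finally show ?thesis using nc by (simp add: power2_eq_square)
    qed
    have "(cmod z)\<^sup>2 \<le> 1" using zz nc c0 by (simp add: cmod_power2)
    then have "z \<in> cball 0 1" by (simp add: power_le_one_iff abs_square_le_1)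
    moreover have "u = ((n + c) / 2) *\<^sub>R chart a b z"
    proof -
      have "1 - (Re z)\<^sup>2 - (Im z)\<^sup>2 = 2 * c / (n + c)" using zz nc by (simp add: field_simps)
      moreover have "u$2 = (n + c) * Re z" "u$3 = (n + c) * Im z" using nc by (auto simp: z_def)
      moreover have "u$1 = c - a * u$2 - b * u$3" by (simp add: c_def line_coord_def)
      ultimately show ?thesis using nc
        by (simp add: vec_eq_iff forall_3 chart_def right_diff_distrib)
    qed
    ultimately show ?thesis using nc by (metis divide_eq_0_iff less_numeral_extra(3) zero_neq_numeral)
  qed
  show ?thesis
  proof (cases "line_coord a b u \<ge> 0")
    case False
    then have "line_coord a b (- u) \<ge> 0" "- u \<noteq> 0" using assms by (auto simp: line_coord_def)
    then obtain z t where "z \<in> cball 0 1" "t \<noteq> 0" "- u = t *\<^sub>R chart a b z" using pos by blast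
    then show ?thesis by (metis minus_minus neg_equal_0_iff_equal scaleR_minus_left)
  qed (use pos assms in blast)
qed

text \<open>On the open disc \<open>line_coord\<close> is positive, which forces
  \<open>t > 0\<close> and then \<open>t = 1\<close>. On the circle this fails, since there
  antipodal points are identified.\<close>

lemma chart_inj:
  assumes "z \<in> ball 0 1" "w \<in> ball 0 1" "chart a b z = t *\<^sub>R chart a b w"
  shows "z = w"
proof -
  have eqs: "Re z = t * Re w" "Im z = t * Im w"
    using assms(3) by (auto simp: vec_eq_iff forall_3 chart_def)
  have e3: "1 - (cmod z)\<^sup>2 = t * (1 - (cmod w)\<^sup>2)"
    using arg_cong[OF assms(3), of "line_coord a b"] by (simp add: line_coord_chart line_coord_scale)
  have pos: "1 - (cmod z)\<^sup>2 > 0" "1 - (cmod w)\<^sup>2 > 0" using assms(1,2) by (auto simp: abs_square_less_1)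
  have "t > 0" using e3 pos by (metis zero_less_mult_pos2)
  have "(cmod z)\<^sup>2 = t\<^sup>2 * (cmod w)\<^sup>2" by (simp add: cmod_power2 eqs power_mult_distrib algebra_simps)
  then have "(t - 1) * (1 + t * (cmod w)\<^sup>2) = 0" using e3 by algebra
  moreover have "1 + t * (cmod w)\<^sup>2 > 0" using \<open>t > 0\<close> by (simp add: add_pos_nonneg)
  ultimately have "t = 1" by simp
  then show ?thesis using eqs by (simp add: complex_eq_iff)
qed

text \<open>The 1-form \<open>F dG - G dF\<close> pulled back along \<open>chart\<close>, its two
  coefficients read as one complex number.\<close>

definition disc_field :: "nat \<Rightarrow> (nat^3 \<Rightarrow> real) \<Rightarrow> (nat^3 \<Rightarrow> real) \<Rightarrow> real \<Rightarrow> real \<Rightarrow> complex \<Rightarrow> complex" where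
  "disc_field d F G a b z = Complex (pencil_field d F G (chart a b z) \<bullet> chart_x a z)
                                    (pencil_field d F G (chart a b z) \<bullet> chart_y b z)"

lemma disc_field_eq_0_iff: "disc_field d F G a b z = 0 \<longleftrightarrow> pencil_field d F G (chart a b z) = 0"
  using orthogonal_frame_zero[of "pencil_field d F G (chart a b z)"] pencil_field_orthogonal
  by (auto simp: disc_field_def complex_eq_iff)

lemma continuous_on_disc_field: "continuous_on UNIV (disc_field d F G a b)"
proof -
  have "isCont (disc_field d F G a b) z" for z
  proof -
    have 1: "isCont (\<lambda>z. pencil_field d F G (chart a b z)) z"
      using has_derivative_compose[OF chart_has_derivative pencil_field_has_derivative]
      by (rule has_derivative_continuous)
    have 2: "isCont (chart_x a) z" "isCont (chart_y b) z"
      using has_derivative_continuous chart_x_has_derivative chart_y_has_derivative by blast+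
    show ?thesis
      unfolding disc_field_def[abs_def] Complex_eq
      by (intro continuous_intros 1 2)
  qed
  then show ?thesis by (simp add: continuous_on_eq_continuous_at)
qed

text \<open>Where the field vanishes, the variation of \<open>chart_x\<close> and
  \<open>chart_y\<close> contributes nothing, so the Jacobian matrix is that of \<open>A\<close>
  tested on these two vectors.\<close>

lemma disc_field_has_derivative_at_zero:
  assumes V: "(pencil_field d F G has_derivative A) (at (chart a b z))"
    and zero: "pencil_field d F G (chart a b z) = 0"
  shows "\<exists>p q. (cmod p)\<^sup>2 - (cmod q)\<^sup>2 =
        (A (chart_x a z) \<bullet> chart_x a z) * (A (chart_y b z) \<bullet> chart_y b z)
        - (A (chart_y b z) \<bullet> chart_x a z) * (A (chart_x a z) \<bullet> chart_y b z)
      \<and> (disc_field d F G a b has_derivative (\<lambda>h. p * h + q * cnj h)) (at z)"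
proof -
  let ?X = "chart_x a z" and ?Y = "chart_y b z"
  define m11 m12 m21 m22 where "m11 = A ?X \<bullet> ?X" and "m12 = A ?Y \<bullet> ?X" and "m21 = A ?X \<bullet> ?Y" and "m22 = A ?Y \<bullet> ?Y"
  \<comment> \<open>The Wirtinger derivatives in \<open>z\<close> and \<open>cnj z\<close>; the
    Jacobian determinant is the difference of their squared moduli, so its sign is the
    index.\<close>
  define p q where "p = Complex ((m11 + m22) / 2) ((m21 - m12) / 2)" and "q = Complex ((m11 - m22) / 2) ((m21 + m12) / 2)"
  have A: "A (Re h *\<^sub>R ?X + Im h *\<^sub>R ?Y) = Re h *\<^sub>R A ?X + Im h *\<^sub>R A ?Y" for h
    using has_derivative_linear[OF V] by (simp add: linear_add linear_scale)
  have DV: "((\<lambda>z. pencil_field d F G (chart a b z)) has_derivative (\<lambda>h. A (Re h *\<^sub>R ?X + Im h *\<^sub>R ?Y))) (at z)"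
    using has_derivative_compose[OF chart_has_derivative V] .
  have comp:
    "((\<lambda>z. pencil_field d F G (chart a b z) \<bullet> chart_x a z) has_derivative (\<lambda>h. A (Re h *\<^sub>R ?X + Im h *\<^sub>R ?Y) \<bullet> ?X)) (at z)"
    "((\<lambda>z. pencil_field d F G (chart a b z) \<bullet> chart_y b z) has_derivative (\<lambda>h. A (Re h *\<^sub>R ?X + Im h *\<^sub>R ?Y) \<bullet> ?Y)) (at z)"
    using has_derivative_inner[OF DV chart_x_has_derivative[of a]]
      has_derivative_inner[OF DV chart_y_has_derivative[of b]] by (simp_all add: zero)
  have "(disc_field d F G a b has_derivative
     (\<lambda>h. of_real (A (Re h *\<^sub>R ?X + Im h *\<^sub>R ?Y) \<bullet> ?X) + \<i> * of_real (A (Re h *\<^sub>R ?X + Im h *\<^sub>R ?Y) \<bullet> ?Y))) (at z)"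
    unfolding disc_field_def[abs_def] Complex_eq
    by (intro has_derivative_add has_derivative_mult_right has_derivative_of_real comp)
  moreover have "of_real (A (Re h *\<^sub>R ?X + Im h *\<^sub>R ?Y) \<bullet> ?X) + \<i> * of_real (A (Re h *\<^sub>R ?X + Im h *\<^sub>R ?Y) \<bullet> ?Y)
      = p * h + q * cnj h" for h
    unfolding A inner_add_left inner_scaleR_left m11_def[symmetric] m12_def[symmetric] m21_def[symmetric] m22_def[symmetric]
    by (simp add: p_def q_def complex_eq_iff field_simps)
  ultimately have "(disc_field d F G a b has_derivative (\<lambda>h. p * h + q * cnj h)) (at z)" by simp
  moreover have "(cmod p)\<^sup>2 - (cmod q)\<^sup>2 = m11 * m22 - m12 * m21"
    unfolding cmod_power2 p_def q_def complex.sel by (simp add: power2_eq_square field_simps)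
  ultimately show ?thesis unfolding m11_def m12_def m21_def m22_def by blast
qed

text \<open>On the circle \<open>chart a b (- z) = - chart a b z\<close>, and the field, of odd
  degree, changes sign. Taken along the outward normal the component of \<open>disc_field\<close>
  changes sign, taken along the tangent it is kept.\<close>

lemma disc_field_antipodal:
  assumes "cmod z = 1" "d \<ge> 1"
  shows "disc_field d F G a b (- z) * cnj (- z) = - cnj (disc_field d F G a b z * cnj z)"
proof -
  define V where "V = pencil_field d F G (chart a b z)"
  define x y where "x = Re z" and "y = Im z"
  have z1: "x\<^sup>2 + y\<^sup>2 = 1" using assms(1) by (metis x_def y_def cmod_power2 one_power2)
  have neg: "chart a b (- z) = (-1) *\<^sub>R chart a b z"
    using z1 by (simp add: chart_def vec_eq_iff forall_3 x_def y_def)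
  have "pencil_field d F G (chart a b (- z)) = (-1) ^ (d + (d - 1)) *\<^sub>R V"
    unfolding neg pencil_field_scale V_def ..
  also have "(-1 :: real) ^ (d + (d - 1)) = -1" using assms(2) by (simp add: uminus_power_if)
  finally have V': "pencil_field d F G (chart a b (- z)) = - V" by simp
  have "V \<bullet> chart a b z = 0" unfolding V_def by (rule pencil_field_orthogonal)
  then have o: "V$1 * (- 2 * a * x - 2 * b * y) + V$2 * (2 * x) + V$3 * (2 * y) = 0"
    using z1 by (simp add: inner_vec_def sum_3 chart_def x_def y_def diff_diff_eq)
  define w1 w2 w1' w2' where "w1 = V$1 * (- 2 * x - 2 * a) + V$2 * 2" and "w2 = V$1 * (- 2 * y - 2 * b) + V$3 * 2"
    and "w1' = - (V$1 * (2 * x - 2 * a) + V$2 * 2)" and "w2' = - (V$1 * (2 * y - 2 * b) + V$3 * 2)"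
  have W: "disc_field d F G a b z = Complex w1 w2"
    unfolding disc_field_def V_def[symmetric]
    by (simp add: inner_vec_def sum_3 chart_x_def chart_y_def x_def y_def w1_def w2_def)
  have W': "disc_field d F G a b (- z) = Complex w1' w2'"
    unfolding disc_field_def V'
    by (simp add: inner_vec_def sum_3 chart_x_def chart_y_def x_def y_def w1'_def w2'_def)
  \<comment> \<open>Both sides equal \<open>- 2 * V$1\<close>; this is where orthogonality to the
    chart vector enters.\<close>
  have "x * w1' + y * w2' = x * w1 + y * w2"
    using z1 o unfolding w1_def w2_def w1'_def w2'_def by algebra
  moreover have "y * w1' - x * w2' = x * w2 - y * w1"
    unfolding w1_def w2_def w1'_def w2'_def by algebra
  ultimately show ?thesis
    unfolding W W' by (simp add: complex_eq_iff x_def y_def algebra_simps)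
qed

section \<open>Nodes and their reality\<close>

lemma real_multiple_of_cross3:
  fixes r u w :: "real^3"
  assumes "r \<bullet> u = 0" "r \<bullet> w = 0" "cross3 u w \<noteq> 0"
  shows "\<exists>k. r = k *\<^sub>R cross3 u w"
proof -
  have "cross3 (cross3 u w) r = 0"
    using assms(1,2) by (simp add: cross3_def inner_vec_def sum_3 vec_eq_iff forall_3) algebra
  then have "collinear {0, cross3 u w, r}" by (simp add: cross_eq_0)
  then show ?thesis using assms(3) by (auto simp: collinear_lemma)
qed

text \<open>Every row is orthogonal to two independent real vectors, hence a multiple of their cross
  product. This carries a real kernel over to the complex rank in \<open>node_pt\<close>.\<close>

lemma rank_complexified_le_1:
  fixes A :: "real^3^3"
  assumes "A *v u = 0" "A *v w = 0" "cross3 u w \<noteq> 0"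
  shows "rank (\<chi> k l. complex_of_real (A$k$l)) \<le> 1"
proof -
  have "rows (\<chi> k l. complex_of_real (A$k$l)) \<subseteq> vec.span {cvec (cross3 u w)}"
  proof
    fix x assume "x \<in> rows (\<chi> k l. complex_of_real (A$k$l))"
    then obtain k where x: "x = cvec (A$k)" by (auto simp: rows_def row_def cvec_def vec_eq_iff)
    have "A$k \<bullet> u = 0" "A$k \<bullet> w = 0"
      using assms(1,2) by (auto simp: vec_eq_iff matrix_vector_mul_component)
    then obtain t where "A$k = t *\<^sub>R cross3 u w" using real_multiple_of_cross3 assms(3) by blast
    then show "x \<in> vec.span {cvec (cross3 u w)}"
      by (simp add: x cvec_scaleR vec.span_base vec.span_scale)
  qed
  then have "vec.dim (rows (\<chi> k l. complex_of_real (A$k$l))) \<le> card {cvec (cross3 u w)}"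
    by (rule vec.dim_le_card) simp
  then show ?thesis by (simp add: row_rank_def_gen)
qed

text \<open>Every nonzero real combination of the generators is a nonzero multiple of a member with
  angle in \<open>{0..<pi}\<close>.\<close>

lemma polar_half_turn:
  assumes "x \<noteq> 0 \<or> y \<noteq> 0"
  shows "\<exists>\<theta>\<in>{0..<pi}. \<exists>t. t \<noteq> 0 \<and> x = t * cos \<theta> \<and> y = t * sin \<theta>"
proof -
  define r where "r = cmod (Complex x y)"
  define \<phi> where "\<phi> = Arg (Complex x y)"
  have r: "r \<noteq> 0" using assms by (auto simp: r_def complex_eq_iff)
  have "rcis r \<phi> = Complex x y" unfolding r_def \<phi>_def by (rule rcis_cmod_Arg)
  then have xy: "x = r * cos \<phi>" "y = r * sin \<phi>" by (auto simp: complex_eq_iff)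
  have \<phi>: "- pi < \<phi>" "\<phi> \<le> pi" unfolding \<phi>_def using mpi_less_Arg Arg_le_pi by auto
  consider "0 \<le> \<phi>" "\<phi> < pi" | "\<phi> = pi" | "\<phi> < 0" using \<phi> by linarith
  then show ?thesis
  proof cases
    case 1 then show ?thesis using xy r by (intro bexI[of _ \<phi>] exI[of _ r]) auto
  next
    case 2 then show ?thesis using xy r by (intro bexI[of _ 0] exI[of _ "- r"]) auto
  next
    case 3 then show ?thesis using xy r \<phi> by (intro bexI[of _ "\<phi> + pi"] exI[of _ "- r"]) auto
  qed
qed

text \<open>Matches points of the disc with angles through the relation "the member is singular
  there", without naming a map.\<close>

lemma bij_betw_of_relation:
  assumes "\<And>x. x \<in> A \<Longrightarrow> \<exists>y\<in>B. R x y" and "\<And>y. y \<in> B \<Longrightarrow> \<exists>x\<in>A. R x y"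
    and "\<And>x y y'. x \<in> A \<Longrightarrow> y \<in> B \<Longrightarrow> y' \<in> B \<Longrightarrow> R x y \<Longrightarrow> R x y' \<Longrightarrow> y = y'"
    and "\<And>x x' y. x \<in> A \<Longrightarrow> x' \<in> A \<Longrightarrow> y \<in> B \<Longrightarrow> R x y \<Longrightarrow> R x' y \<Longrightarrow> x = x'"
  shows "\<exists>f. bij_betw f A B"
proof -
  obtain f where f: "\<And>x. x \<in> A \<Longrightarrow> f x \<in> B \<and> R x (f x)" using assms(1) by metis
  have "inj_on f A" by (rule inj_onI) (metis f assms(4))
  moreover have "f ` A = B"
  proof
    show "B \<subseteq> f ` A"
    proof
      fix y assume y: "y \<in> B"
      then obtain x where x: "x \<in> A" "R x y" using assms(2) by blast
      then have "y = f x" using assms(3) f y by blast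
      with x show "y \<in> f ` A" by blast
    qed
  qed (use f in auto)
  ultimately show ?thesis by (auto simp: bij_betw_def)
qed

section \<open>Binary quadratic forms\<close>

lemma form_hess_inner_sym: "v \<bullet> (form_hess d c u *v w) = w \<bullet> (form_hess d c u *v v)"
  using form_hess_sym[of d c u 1 2] form_hess_sym[of d c u 1 3] form_hess_sym[of d c u 2 3]
  by (simp add: inner_vec_def matrix_vector_mult_def sum_3 algebra_simps)

lemma binary_form_definite:
  fixes A B C x y :: real
  assumes "A * C - B\<^sup>2 > 0" "x \<noteq> 0 \<or> y \<noteq> 0"
  shows "A * (A * x\<^sup>2 + 2 * B * x * y + C * y\<^sup>2) > 0"
proof -
  have *: "A * (A * x\<^sup>2 + 2 * B * x * y + C * y\<^sup>2) = (A * x + B * y)\<^sup>2 + (A * C - B\<^sup>2) * y\<^sup>2"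
    by (simp add: algebra_simps power2_eq_square)
  have "A \<noteq> 0" using assms(1) by (auto simp: not_less)
  show ?thesis
  proof (cases "y = 0")
    case True
    then show ?thesis using assms(2) \<open>A \<noteq> 0\<close> unfolding * by simp
  next
    case False
    then show ?thesis using assms(1) unfolding * by (intro add_nonneg_pos) auto
  qed
qed

lemma binary_form_indefinite:
  fixes A B C :: real
  assumes "A * C - B\<^sup>2 < 0"
  shows "\<exists>x y. A * x\<^sup>2 + 2 * B * x * y + C * y\<^sup>2 < 0" "\<exists>x y. A * x\<^sup>2 + 2 * B * x * y + C * y\<^sup>2 > 0"
    "\<exists>x y. (x \<noteq> 0 \<or> y \<noteq> 0) \<and> A * x\<^sup>2 + 2 * B * x * y + C * y\<^sup>2 = 0"
proof -
  define q where "q x y = A * x\<^sup>2 + 2 * B * x * y + C * y\<^sup>2" for x y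
  have qA: "A * q x y = (A * x + B * y)\<^sup>2 + (A * C - B\<^sup>2) * y\<^sup>2" for x y
    by (simp add: q_def algebra_simps power2_eq_square)
  have "(\<exists>x y. q x y < 0) \<and> (\<exists>x y. q x y > 0) \<and> (\<exists>x y. (x \<noteq> 0 \<or> y \<noteq> 0) \<and> q x y = 0)"
  proof (cases "A = 0")
    case True
    then have "B \<noteq> 0" using assms by auto
    have "q x 1 = 2 * B * x + C" for x using True by (simp add: q_def)
    then have "q ((- 1 - C) / (2 * B)) 1 = - 1" "q ((1 - C) / (2 * B)) 1 = 1" "q (- C / (2 * B)) 1 = 0"
      using \<open>B \<noteq> 0\<close> by auto
    then show ?thesis by (metis less_numeral_extra(1) neg_less_0_iff_less one_neq_zero)
  next
    case False
    define s where "s = sqrt (B\<^sup>2 - A * C)"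
    have s: "s\<^sup>2 = B\<^sup>2 - A * C" using assms by (simp add: s_def)
    \<comment> \<open>At \<open>(- B, A)\<close> the square \<open>(A * x + B * y)\<^sup>2\<close>
      vanishes and the negative term remains; at \<open>(s - B, A)\<close> it equals
      \<open>s\<^sup>2 * A\<^sup>2\<close> and cancels that term.\<close>
    have "A * q 1 0 = A\<^sup>2" "A * q (- B) A = (A * C - B\<^sup>2) * A\<^sup>2" "A * q (s - B) A = (s\<^sup>2 + (A * C - B\<^sup>2)) * A\<^sup>2"
      unfolding qA by (auto simp: algebra_simps power2_eq_square)
    then have v: "A * q 1 0 > 0" "A * q (- B) A < 0" "A * q (s - B) A = 0"
      using False assms s by (auto simp: mult_less_0_iff)
    from v(1,2) False have "(\<exists>x y. q x y < 0) \<and> (\<exists>x y. q x y > 0)"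
      by (cases "A > 0") (auto simp: zero_less_mult_iff mult_less_0_iff)
    moreover from v(3) False have "q (s - B) A = 0" by simp
    ultimately show ?thesis using False by blast
  qed
  then show "\<exists>x y. A * x\<^sup>2 + 2 * B * x * y + C * y\<^sup>2 < 0" "\<exists>x y. A * x\<^sup>2 + 2 * B * x * y + C * y\<^sup>2 > 0"
    "\<exists>x y. (x \<noteq> 0 \<or> y \<noteq> 0) \<and> A * x\<^sup>2 + 2 * B * x * y + C * y\<^sup>2 = 0"
    unfolding q_def by blast+
qed

section \<open>Complex conjugation and real representatives\<close>

lemma mono_scale: "mono (a *s v) e = a ^ (\<Sum>k\<in>UNIV. e$k) * mono v e"
  by (simp add: mono_def prod_UNIV_3 sum_3 power_mult_distrib power_add)

lemma singular_pt_scale: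
  assumes "singular_pt d c v" "a \<noteq> 0"
  shows "singular_pt d c (a *s v)"
proof -
  have "heval d c (a *s v) = a ^ d * heval d c v"
    by (simp add: heval_def mono_scale sum_distrib_left degd_def algebra_simps)
  moreover have "hgrad d c k (a *s v) = a ^ (d - 1) * hgrad d c k v" for k
  proof -
    have "c e * of_nat (e$k) * mono (a *s v) (dexp k e) = a ^ (d - 1) * (c e * of_nat (e$k) * mono v (dexp k e))"
      if "e \<in> degd d" for e
      using that sum_dexp[of e k] by (cases "e$k = 0") (auto simp: mono_scale degd_def)
    then show ?thesis by (auto simp: hgrad_def sum_distrib_left intro!: sum.cong)
  qed
  ultimately show ?thesis using assms by (auto simp: singular_pt_def vec_eq_iff)
qed

lemma singular_pt_cnj:
  assumes "singular_pt d (\<lambda>e. of_real (c e)) v"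
  shows "singular_pt d (\<lambda>e. of_real (c e)) (\<chi> m. cnj (v$m))"
proof -
  have m: "mono (\<chi> m. cnj (v$m)) e = cnj (mono v e)" for e
    by (simp add: mono_def)
  have "heval d (\<lambda>e. of_real (c e)) (\<chi> m. cnj (v$m)) = cnj (heval d (\<lambda>e. of_real (c e)) v)"
    by (simp add: heval_def m)
  moreover have "hgrad d (\<lambda>e. of_real (c e)) k (\<chi> m. cnj (v$m)) = cnj (hgrad d (\<lambda>e. of_real (c e)) k v)" for k
    by (simp add: hgrad_def m)
  moreover have "(\<chi> m. cnj (v$m)) \<noteq> 0" using assms by (auto simp: singular_pt_def vec_eq_iff)
  ultimately show ?thesis using assms by (simp add: singular_pt_def)
qed

lemma in_ppt_self: "v \<in> ppt v"
  unfolding ppt_def by (auto intro!: exI[of _ 1])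

lemma ppt_scale: "a \<noteq> 0 \<Longrightarrow> ppt (a *s v) = ppt v"
  unfolding ppt_def
proof (intro set_eqI iffI)
  fix x assume "a \<noteq> 0" "x \<in> {b *s v | b. b \<noteq> 0}"
  then obtain b where "x = b *s v" "b \<noteq> 0" by blast
  then show "x \<in> {b *s (a *s v) | b. b \<noteq> 0}" using \<open>a \<noteq> 0\<close>
    by (intro CollectI exI[of _ "b / a"]) auto
qed auto

lemma real_representative:
  assumes "ppt (\<chi> m. cnj (v$m)) = ppt v"
  shows "\<exists>a u. a \<noteq> 0 \<and> a *s v = cvec u"
proof -
  have "(\<chi> m. cnj (v$m)) \<in> ppt v" using assms in_ppt_self by metis
  then obtain b where b: "(\<chi> m. cnj (v$m)) = b *s v" unfolding ppt_def by blast
  then have bm: "cnj (v$m) = b * v$m" for m by (simp add: vec_eq_iff)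
  \<comment> \<open>With \<open>cnj v = b v\<close>, the vector \<open>(1 + b) v = v + cnj v\<close>
    is real; for \<open>b = -1\<close> that factor is 0, but then \<open>v\<close> is purely
    imaginary and \<open>\<i>\<close> serves.\<close>
  define a where "a = (if b = -1 then \<i> else 1 + b)"
  have "a \<noteq> 0" by (auto simp: a_def add_eq_0_iff)
  moreover have "realvec (a *s v)"
    unfolding realvec_def
  proof
    fix m
    have "(a *s v) $ m = (if b = -1 then \<i> * v$m else v$m + cnj (v$m))"
      by (simp add: a_def bm algebra_simps)
    moreover have "\<i> * v$m \<in> \<real>" if "b = -1"
      using bm[of m] that by (auto simp: complex_is_Real_iff complex_eq_iff)
    ultimately show "(a *s v) $ m \<in> \<real>" by (auto simp: complex_is_Real_iff)
  qed
  ultimately show ?thesis using realvec_imp_cvec by blast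
qed

section \<open>Nodal pencils\<close>

locale nodal_pencil =
  fixes d :: nat and F G :: "nat^3 \<Rightarrow> real"
  assumes degree: "d \<ge> 2"
    and nodal: "\<forall>\<theta>\<in>{0..<pi}. \<forall>v. singular_pt d (rmem F G \<theta>) v \<longrightarrow>
            node_pt d (rmem F G \<theta>) v \<and> ppt v \<notin> base_points d F G \<and>
            (\<forall>w. singular_pt d (rmem F G \<theta>) w \<longrightarrow> ppt w = ppt v)"
begin

abbreviation member :: "real \<Rightarrow> nat^3 \<Rightarrow> real" where
  "member \<theta> \<equiv> \<lambda>e. cos \<theta> * F e + sin \<theta> * G e"

definition real_singular :: "real \<Rightarrow> real^3 \<Rightarrow> bool" where
  "real_singular \<theta> u \<longleftrightarrow> \<theta> \<in> {0..<pi} \<and> u \<noteq> 0 \<and> form_grad d (member \<theta>) u = 0"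

definition base :: "real^3 \<Rightarrow> bool" where
  "base u \<longleftrightarrow> form d F u = 0 \<and> form d G u = 0"

lemma real_singular_iff: "real_singular \<theta> u \<longleftrightarrow> \<theta> \<in> {0..<pi} \<and> singular_pt d (rmem F G \<theta>) (cvec u)"
proof -
  have "singular_pt d (rmem F G \<theta>) (cvec u) \<longleftrightarrow> u \<noteq> 0 \<and> form_grad d (member \<theta>) u = 0"
    unfolding rmem_eq by (rule singular_pt_cvec) (use degree in simp)
  then show ?thesis by (auto simp: real_singular_def)
qed

lemma heval_base:
  "heval d (pmem F G 1 0) (cvec u) = of_real (form d F u)" "heval d (pmem F G 0 1) (cvec u) = of_real (form d G u)"
  using heval_cvec[of d F u] heval_cvec[of d G u] by (simp_all add: pmem_def)

lemma base_imp_base_points: "u \<noteq> 0 \<Longrightarrow> base u \<Longrightarrow> ppt (cvec u) \<in> base_points d F G"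
  unfolding base_points_def base_def by (auto simp: heval_base intro!: exI[of _ "cvec u"])

lemma real_singular_node:
  assumes "real_singular \<theta> u"
  shows "node_pt d (rmem F G \<theta>) (cvec u)" "ppt (cvec u) \<notin> base_points d F G"
    "singular_pt d (rmem F G \<theta>) w \<Longrightarrow> ppt w = ppt (cvec u)"
  using assms nodal unfolding real_singular_iff by blast+

lemma real_singular_not_base: "real_singular \<theta> u \<Longrightarrow> \<not> base u"
  using real_singular_node(2) base_imp_base_points unfolding real_singular_def by blast

lemma real_singular_unique:
  assumes "real_singular \<theta> u" "real_singular \<theta> w"
  shows "\<exists>t. w = t *\<^sub>R u"
proof -
  have "ppt (cvec w) = ppt (cvec u)"
    using real_singular_node(3)[OF assms(1)] assms(2) unfolding real_singular_iff by blast
  then have "cvec w \<in> ppt (cvec u)" using in_ppt_self by metis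
  then obtain a where "cvec w = a *s cvec u" unfolding ppt_def by blast
  then show ?thesis using cvec_multiple_real assms(1) unfolding real_singular_def by blast
qed

lemma real_singular_scale: "real_singular \<theta> u \<Longrightarrow> t \<noteq> 0 \<Longrightarrow> real_singular \<theta> (t *\<^sub>R u)"
  by (simp add: real_singular_def form_grad_scale)

lemma real_singular_form: "real_singular \<theta> u \<Longrightarrow> form d (member \<theta>) u = 0"
  using form_euler[of d "member \<theta>" u] degree by (simp add: real_singular_def)

text \<open>A point on two different members lies on all of them, so it would be a base
  point.\<close>

lemma real_singular_angle_unique:
  assumes "real_singular \<theta> u" "real_singular \<phi> u"
  shows "\<theta> = \<phi>"
proof -
  let ?f = "form d F u" and ?g = "form d G u"
  have e: "cos \<theta> * ?f + sin \<theta> * ?g = 0" "cos \<phi> * ?f + sin \<phi> * ?g = 0"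
    using real_singular_form[OF assms(1)] real_singular_form[OF assms(2)] by (simp_all add: form_lincomb)
  have "sin (\<theta> - \<phi>) * ?f = 0" "sin (\<theta> - \<phi>) * ?g = 0"
    using e unfolding sin_diff by algebra+
  then have "sin (\<theta> - \<phi>) = 0" using real_singular_not_base[OF assms(1)] by (auto simp: base_def)
  moreover have "- pi < \<theta> - \<phi>" "\<theta> - \<phi> < pi" using assms by (auto simp: real_singular_def)
  ultimately show ?thesis using sin_eq_0_pi[of "\<theta> - \<phi>"] by simp
qed

lemma pencil_field_zero_iff:
  assumes "u \<noteq> 0"
  shows "pencil_field d F G u = 0 \<longleftrightarrow> base u \<or> (\<exists>\<theta>. real_singular \<theta> u)"
proof
  assume V: "pencil_field d F G u = 0"
  have "\<exists>\<theta>. real_singular \<theta> u" if "\<not> base u"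
  proof -
    \<comment> \<open>The member through a non-base point \<open>u\<close> has coefficients
      proportional to \<open>(G(u), - F(u))\<close>, and with these very coefficients its gradient
      at \<open>u\<close> is minus the field.\<close>
    have "form d G u \<noteq> 0 \<or> - form d F u \<noteq> 0" using that by (auto simp: base_def)
    then obtain \<theta> t where t: "\<theta> \<in> {0..<pi}" "t \<noteq> 0" "form d G u = t * cos \<theta>" "- form d F u = t * sin \<theta>"
      using polar_half_turn by metis
    have "form d F u = - (t * sin \<theta>)" using t(4) by linarith
    then have "t *\<^sub>R form_grad d (member \<theta>) u = - pencil_field d F G u"
      unfolding form_lincomb pencil_field_def t(3) by (simp add: scaleR_add_right)
    then have "form_grad d (member \<theta>) u = 0" using V t(2) by simp
    then show ?thesis using t(1) assms by (auto simp: real_singular_def)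
  qed
  then show "base u \<or> (\<exists>\<theta>. real_singular \<theta> u)" by blast
next
  assume "base u \<or> (\<exists>\<theta>. real_singular \<theta> u)"
  then show "pencil_field d F G u = 0"
  proof
    assume "\<exists>\<theta>. real_singular \<theta> u"
    then obtain \<theta> where "real_singular \<theta> u" by blast
    then have "form d (member \<theta>) u = 0" "form_grad d (member \<theta>) u = 0"
      using real_singular_form by (auto simp: real_singular_def)
    then show ?thesis by (subst pencil_field_rotate[of d \<theta>, symmetric]) (simp add: pencil_field_def)
  qed (simp add: base_def pencil_field_def)
qed

text \<open>The determinant of the Hessian form restricted to the plane of \<open>chart_x\<close>
  and \<open>chart_y\<close>, which is complementary to the point itself.\<close>

definition node_disc :: "real \<Rightarrow> real \<Rightarrow> real \<Rightarrow> complex \<Rightarrow> real" where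
  "node_disc \<theta> a b z =
    (let H = form_hess d (member \<theta>) (chart a b z); X = chart_x a z; Y = chart_y b z
     in (X \<bullet> (H *v X)) * (Y \<bullet> (H *v Y)) - (X \<bullet> (H *v Y))\<^sup>2)"

lemma real_singular_hess: "real_singular \<theta> u \<Longrightarrow> form_hess d (member \<theta>) u *v u = 0"
  by (simp add: form_grad_euler real_singular_def)

text \<open>A vanishing determinant gives \<open>w\<close> in the plane with \<open>H w\<close>
  orthogonal to the plane; by symmetry and \<open>H u = 0\<close> it is also orthogonal to
  \<open>u\<close>, so \<open>H w = 0\<close>. Then \<open>u\<close> and \<open>w\<close> span a
  kernel too large for rank 2.\<close>

lemma node_disc_nonzero:
  assumes "real_singular \<theta> (chart a b z)"
  shows "node_disc \<theta> a b z \<noteq> 0"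
proof
  let ?u = "chart a b z" and ?X = "chart_x a z" and ?Y = "chart_y b z"
  let ?H = "form_hess d (member \<theta>) (chart a b z)"
  assume "node_disc \<theta> a b z = 0"
  define A B C where "A = ?X \<bullet> (?H *v ?X)" and "B = ?X \<bullet> (?H *v ?Y)" and "C = ?Y \<bullet> (?H *v ?Y)"
  have AC: "A * C - B\<^sup>2 = 0"
    using \<open>node_disc \<theta> a b z = 0\<close> by (simp add: node_disc_def Let_def A_def B_def C_def)
  have B': "?Y \<bullet> (?H *v ?X) = B" unfolding B_def by (rule form_hess_inner_sym)
  have "\<exists>\<alpha> \<beta>. (\<alpha> \<noteq> 0 \<or> \<beta> \<noteq> 0) \<and> \<alpha> * A + \<beta> * B = 0 \<and> \<alpha> * B + \<beta> * C = 0"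
  proof (cases "A = 0 \<and> B = 0")
    case True
    then show ?thesis by (intro exI[of _ 1] exI[of _ 0]) auto
  next
    case False
    then show ?thesis using AC
      by (intro exI[of _ B] exI[of _ "- A"]) (auto simp: power2_eq_square)
  qed
  then obtain \<alpha> \<beta> where ab: "\<alpha> \<noteq> 0 \<or> \<beta> \<noteq> 0" "\<alpha> * A + \<beta> * B = 0" "\<alpha> * B + \<beta> * C = 0" by blast
  define w where "w = \<alpha> *\<^sub>R ?X + \<beta> *\<^sub>R ?Y"
  have Hw: "?H *v w = 0"
  proof (rule orthogonal_frame_zero)
    have eq: "?H *v w = \<alpha> *\<^sub>R (?H *v ?X) + \<beta> *\<^sub>R (?H *v ?Y)"
      by (simp add: w_def matrix_vector_right_distrib matrix_vector_mult_scaleR)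
    show "(?H *v w) \<bullet> ?X = 0" "(?H *v w) \<bullet> ?Y = 0"
      using ab(2,3) B' unfolding eq
      by (simp_all add: inner_add_left inner_commute[of "?H *v _"] A_def[symmetric] B_def[symmetric] C_def[symmetric])
    show "(?H *v w) \<bullet> ?u = 0"
      using form_hess_inner_sym[of ?u d "member \<theta>" ?u w] real_singular_hess[OF assms]
      by (simp add: inner_commute)
  qed
  have "cross3 ?u w \<noteq> 0"
  proof
    assume "cross3 ?u w = 0"
    then obtain t where "w = t *\<^sub>R ?u"
      using chart_nonzero[of a b z] by (auto simp: cross_eq_0 collinear_lemma)
    then show False using chart_frame_independent ab(1) unfolding w_def by blast
  qed
  then have "rank (\<chi> k l. complex_of_real (?H$k$l)) \<le> 1"
    using rank_complexified_le_1 real_singular_hess[OF assms] Hw by blast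
  moreover have "hessian d (rmem F G \<theta>) (cvec ?u) = (\<chi> k l. complex_of_real (?H$k$l))"
    unfolding hessian_def rmem_eq hhess_cvec ..
  ultimately show False using real_singular_node(1)[OF assms] by (simp add: node_pt_def)
qed

text \<open>The point lies in the radical of its own Hessian, so the tangent cone is a binary form
  in the two plane coordinates.\<close>

lemma tcone_chart:
  assumes "real_singular \<theta> (chart a b z)"
  defines "H \<equiv> form_hess d (member \<theta>) (chart a b z)"
  shows "tcone d (rmem F G \<theta>) (cvec (chart a b z)) (\<alpha> *\<^sub>R chart_x a z + \<beta> *\<^sub>R chart_y b z + \<gamma> *\<^sub>R chart a b z)
    = (chart_x a z \<bullet> (H *v chart_x a z)) * \<alpha>\<^sup>2 + 2 * (chart_x a z \<bullet> (H *v chart_y b z)) * \<alpha> * \<beta>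
      + (chart_y b z \<bullet> (H *v chart_y b z)) * \<beta>\<^sup>2"
proof -
  let ?u = "chart a b z" and ?X = "chart_x a z" and ?Y = "chart_y b z"
  have Hu: "H *v ?u = 0" unfolding H_def by (rule real_singular_hess[OF assms(1)])
  have uH: "?u \<bullet> (H *v v) = 0" for v
    using form_hess_inner_sym[of ?u d "member \<theta>" ?u v] Hu unfolding H_def by simp
  have YX: "?Y \<bullet> (H *v ?X) = ?X \<bullet> (H *v ?Y)" unfolding H_def by (rule form_hess_inner_sym)
  have "tcone d (rmem F G \<theta>) (cvec ?u) (\<alpha> *\<^sub>R ?X + \<beta> *\<^sub>R ?Y + \<gamma> *\<^sub>R ?u)
     = (\<alpha> *\<^sub>R ?X + \<beta> *\<^sub>R ?Y + \<gamma> *\<^sub>R ?u) \<bullet> (H *v (\<alpha> *\<^sub>R ?X + \<beta> *\<^sub>R ?Y + \<gamma> *\<^sub>R ?u))"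
    unfolding rmem_eq tcone_cvec H_def ..
  also have "\<dots> = (?X \<bullet> (H *v ?X)) * \<alpha>\<^sup>2 + 2 * (?X \<bullet> (H *v ?Y)) * \<alpha> * \<beta> + (?Y \<bullet> (H *v ?Y)) * \<beta>\<^sup>2"
    by (simp add: matrix_vector_right_distrib matrix_vector_mult_scaleR inner_add_left inner_add_right Hu uH YX
        power2_eq_square algebra_simps)
  finally show ?thesis .
qed

lemma node_type_chart:
  assumes S: "real_singular \<theta> (chart a b z)"
  shows "crossing_node d (rmem F G \<theta>) (cvec (chart a b z)) \<longleftrightarrow> node_disc \<theta> a b z < 0" (is ?cr)
    and "solitary_node d (rmem F G \<theta>) (cvec (chart a b z)) \<longleftrightarrow> node_disc \<theta> a b z > 0" (is ?sol)
proof -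
  let ?u = "chart a b z" and ?X = "chart_x a z" and ?Y = "chart_y b z"
  let ?H = "form_hess d (member \<theta>) (chart a b z)"
  define A B C where "A = ?X \<bullet> (?H *v ?X)" and "B = ?X \<bullet> (?H *v ?Y)" and "C = ?Y \<bullet> (?H *v ?Y)"
  have disc: "node_disc \<theta> a b z = A * C - B\<^sup>2" by (simp add: node_disc_def Let_def A_def B_def C_def)
  have node: "node_pt d (rmem F G \<theta>) (cvec ?u)" using real_singular_node(1)[OF S] .
  let ?T = "tcone d (rmem F G \<theta>) (cvec ?u)"
  have T: "?T (\<alpha> *\<^sub>R ?X + \<beta> *\<^sub>R ?Y + \<gamma> *\<^sub>R ?u) = A * \<alpha>\<^sup>2 + 2 * B * \<alpha> * \<beta> + C * \<beta>\<^sup>2" for \<alpha> \<beta> \<gamma>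
    using tcone_chart[OF S] by (simp add: A_def B_def C_def)
  have T0: "?T (\<alpha> *\<^sub>R ?X + \<beta> *\<^sub>R ?Y) = A * \<alpha>\<^sup>2 + 2 * B * \<alpha> * \<beta> + C * \<beta>\<^sup>2" for \<alpha> \<beta>
    using T[of \<alpha> \<beta> 0] by simp
  have pos: "solitary_node d (rmem F G \<theta>) (cvec ?u) \<and> \<not> crossing_node d (rmem F G \<theta>) (cvec ?u)"
    if p: "A * C - B\<^sup>2 > 0"
  proof
    show "solitary_node d (rmem F G \<theta>) (cvec ?u)"
      unfolding solitary_node_def
    proof (intro conjI node realvec_cvec allI impI)
      fix v assume v0: "?T v = 0"
      obtain \<alpha> \<beta> \<gamma> where v: "v = \<alpha> *\<^sub>R ?X + \<beta> *\<^sub>R ?Y + \<gamma> *\<^sub>R ?u" using chart_frame_span by blast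
      have "\<alpha> = 0 \<and> \<beta> = 0"
        using binary_form_definite[OF p, of \<alpha> \<beta>] v0 unfolding v T by auto
      then have "v = \<gamma> *\<^sub>R ?u" using v by simp
      then show "\<exists>a. cvec v = a *s cvec ?u" using cvec_scaleR by metis
    qed
    \<comment> \<open>A definite binary form has the sign of \<open>A\<close> throughout, so the two
      signs of a crossing cannot both occur.\<close>
    have "A * ?T v \<ge> 0" for v
    proof -
      obtain \<alpha> \<beta> \<gamma> where v: "v = \<alpha> *\<^sub>R ?X + \<beta> *\<^sub>R ?Y + \<gamma> *\<^sub>R ?u" using chart_frame_span by blast
      show ?thesis
      proof (cases "\<alpha> = 0 \<and> \<beta> = 0")
        case False
        then show ?thesis using binary_form_definite[OF p, of \<alpha> \<beta>] unfolding v T by auto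
      qed (unfold v T, simp)
    qed
    moreover have "A \<noteq> 0" using p by (auto simp: not_less)
    ultimately show "\<not> crossing_node d (rmem F G \<theta>) (cvec ?u)"
      unfolding crossing_node_def by (smt (verit) mult_pos_neg mult_neg_pos)
  qed
  have neg: "\<not> solitary_node d (rmem F G \<theta>) (cvec ?u) \<and> crossing_node d (rmem F G \<theta>) (cvec ?u)"
    if n: "A * C - B\<^sup>2 < 0"
  proof
    show "crossing_node d (rmem F G \<theta>) (cvec ?u)"
      unfolding crossing_node_def using node binary_form_indefinite(1,2)[OF n] T0
      by (metis realvec_cvec)
    obtain \<alpha> \<beta> where ab: "\<alpha> \<noteq> 0 \<or> \<beta> \<noteq> 0" "?T (\<alpha> *\<^sub>R ?X + \<beta> *\<^sub>R ?Y) = 0"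
      using binary_form_indefinite(3)[OF n] T0 by metis
    show "\<not> solitary_node d (rmem F G \<theta>) (cvec ?u)"
    proof
      assume "solitary_node d (rmem F G \<theta>) (cvec ?u)"
      then obtain k where "cvec (\<alpha> *\<^sub>R ?X + \<beta> *\<^sub>R ?Y) = k *s cvec ?u"
        using ab(2) unfolding solitary_node_def by blast
      then have "\<alpha> *\<^sub>R ?X + \<beta> *\<^sub>R ?Y = Re k *\<^sub>R ?u" using cvec_multiple_real chart_nonzero by blast
      then show False using chart_frame_independent ab(1) by blast
    qed
  qed
  show ?cr ?sol using pos neg node_disc_nonzero[OF S] unfolding disc
    by (meson linorder_neqE_linordered_idom order_less_asym)+
qed

text \<open>Rescaling the point multiplies the tangent cone by \<open>t ^ (d - 2)\<close>, possibly
  negative. Both types survive this: a crossing asks for both signs, a solitary node only looks at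
  the zero set.\<close>

lemma node_type_scale:
  assumes S: "real_singular \<theta> u" and t: "t \<noteq> 0"
  shows "crossing_node d (rmem F G \<theta>) (cvec (t *\<^sub>R u)) \<longleftrightarrow> crossing_node d (rmem F G \<theta>) (cvec u)"
    and "solitary_node d (rmem F G \<theta>) (cvec (t *\<^sub>R u)) \<longleftrightarrow> solitary_node d (rmem F G \<theta>) (cvec u)"
proof -
  have node: "node_pt d (rmem F G \<theta>) (cvec u)" "node_pt d (rmem F G \<theta>) (cvec (t *\<^sub>R u))"
    using real_singular_node(1) S real_singular_scale[OF S t] by blast+
  define k where "k = t ^ (d - 2)"
  have k: "k \<noteq> 0" using t by (simp add: k_def)
  have T: "tcone d (rmem F G \<theta>) (cvec (t *\<^sub>R u)) w = k * tcone d (rmem F G \<theta>) (cvec u) w" for w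
    unfolding rmem_eq tcone_cvec form_hess_scale k_def by (simp add: scaleR_matrix_vector_assoc[symmetric])
  show "crossing_node d (rmem F G \<theta>) (cvec (t *\<^sub>R u)) \<longleftrightarrow> crossing_node d (rmem F G \<theta>) (cvec u)"
    using node k by (cases "k > 0") (auto simp: crossing_node_def T mult_less_0_iff zero_less_mult_iff)
  have "(\<exists>a. w = a *s cvec (t *\<^sub>R u)) \<longleftrightarrow> (\<exists>a. w = a *s cvec u)" for w
  proof
    assume "\<exists>a. w = a *s cvec u"
    then obtain a where "w = a *s cvec u" by blast
    then have "w = (a / of_real t) *s cvec (t *\<^sub>R u)" using t by (simp add: cvec_scaleR)
    then show "\<exists>a. w = a *s cvec (t *\<^sub>R u)" by blast
  qed (auto simp: cvec_scaleR)
  then show "solitary_node d (rmem F G \<theta>) (cvec (t *\<^sub>R u)) \<longleftrightarrow> solitary_node d (rmem F G \<theta>) (cvec u)"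
    using node k by (simp add: solitary_node_def T)
qed

text \<open>With \<open>F = G = 0\<close> at the point, the derivative sends \<open>h\<close> to
  \<open>(f \<bullet> h) g - (g \<bullet> h) f\<close>. On the frame this is an antisymmetric matrix
  with entries \<open>D\<close> and \<open>- D\<close>, of determinant
  \<open>D\<^sup>2\<close>.\<close>

lemma disc_field_derivative_base:
  assumes B: "base (chart a b z)"
  shows "\<exists>p q. cmod q < cmod p \<and> (disc_field d F G a b has_derivative (\<lambda>h. p * h + q * cnj h)) (at z)"
proof -
  let ?u = "chart a b z" and ?X = "chart_x a z" and ?Y = "chart_y b z"
  define f g where "f = form_grad d F ?u" and "g = form_grad d G ?u"
  have eul: "f \<bullet> ?u = 0" "g \<bullet> ?u = 0" using B by (auto simp: f_def g_def form_euler base_def)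
  define D where "D = (f \<bullet> ?X) * (g \<bullet> ?Y) - (f \<bullet> ?Y) * (g \<bullet> ?X)"
  have "D \<noteq> 0"
  proof
    assume D: "D = 0"
    have "\<exists>x y. (x \<noteq> 0 \<or> y \<noteq> 0) \<and> x * (f \<bullet> ?X) + y * (g \<bullet> ?X) = 0 \<and> x * (f \<bullet> ?Y) + y * (g \<bullet> ?Y) = 0"
    proof (cases "f \<bullet> ?X = 0 \<and> g \<bullet> ?X = 0")
      case True
      show ?thesis
      proof (cases "f \<bullet> ?Y = 0 \<and> g \<bullet> ?Y = 0")
        case False
        then show ?thesis using True by (intro exI[of _ "g \<bullet> ?Y"] exI[of _ "- (f \<bullet> ?Y)"]) auto
      qed (use True in \<open>auto intro!: exI[of _ 1]\<close>)
    next
      case False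
      then show ?thesis using D
        by (intro exI[of _ "g \<bullet> ?X"] exI[of _ "- (f \<bullet> ?X)"]) (auto simp: D_def algebra_simps)
    qed
    then obtain x y where xy: "x \<noteq> 0 \<or> y \<noteq> 0" "x * (f \<bullet> ?X) + y * (g \<bullet> ?X) = 0" "x * (f \<bullet> ?Y) + y * (g \<bullet> ?Y) = 0"
      by blast
    have "x *\<^sub>R f + y *\<^sub>R g = 0"
      by (rule orthogonal_frame_zero[of _ a z b]) (use xy eul in \<open>auto simp: inner_add_left\<close>)
    moreover obtain \<theta> t where t: "\<theta> \<in> {0..<pi}" "t \<noteq> 0" "x = t * cos \<theta>" "y = t * sin \<theta>"
      using polar_half_turn xy(1) by metis
    ultimately have "t *\<^sub>R form_grad d (member \<theta>) ?u = 0"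
      unfolding form_lincomb f_def g_def by (simp add: scaleR_add_right)
    then have "real_singular \<theta> ?u" using t chart_nonzero by (simp add: real_singular_def)
    then show False using real_singular_not_base B by blast
  qed
  have zero: "pencil_field d F G ?u = 0" using B chart_nonzero by (simp add: pencil_field_zero_iff)
  obtain p q where pq: "(disc_field d F G a b has_derivative (\<lambda>h. p * h + q * cnj h)) (at z)"
    "(cmod p)\<^sup>2 - (cmod q)\<^sup>2 = D\<^sup>2"
    using disc_field_has_derivative_at_zero[OF pencil_field_has_derivative zero] B
    by (auto simp: base_def f_def[symmetric] g_def[symmetric] D_def inner_diff_left algebra_simps power2_eq_square)
  have "(cmod q)\<^sup>2 < (cmod p)\<^sup>2" using pq(2) \<open>D \<noteq> 0\<close> by (metis diff_gt_0_iff_gt zero_less_power2)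
  then have "cmod q < cmod p" by (rule power2_less_imp_less) simp
  then show ?thesis using pq(1) by blast
qed

text \<open>After rotating the pencil so that the singular member comes first, only
  \<open>- k\<close> times its Hessian survives, where \<open>k\<close> is the value of the other
  generator. The determinant of a 2 by 2 matrix scales by \<open>k\<^sup>2\<close>, so the sign of
  \<open>k\<close> is irrelevant.\<close>

lemma disc_field_derivative_node:
  assumes S: "real_singular \<theta> (chart a b z)"
  shows "\<exists>p q k. k > 0 \<and> (cmod p)\<^sup>2 - (cmod q)\<^sup>2 = k * node_disc \<theta> a b z \<and>
     (disc_field d F G a b has_derivative (\<lambda>h. p * h + q * cnj h)) (at z)"
proof -
  let ?u = "chart a b z" and ?X = "chart_x a z" and ?Y = "chart_y b z"
  let ?K = "\<lambda>e. - sin \<theta> * F e + cos \<theta> * G e"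
  let ?H = "form_hess d (member \<theta>) ?u"
  have h0: "form d (member \<theta>) ?u = 0" "form_grad d (member \<theta>) ?u = 0"
    using real_singular_form[OF S] S by (auto simp: real_singular_def)
  define k where "k = form d ?K ?u"
  have "k \<noteq> 0"
  proof
    assume "k = 0"
    then have "- sin \<theta> * form d F ?u + cos \<theta> * form d G ?u = 0" "cos \<theta> * form d F ?u + sin \<theta> * form d G ?u = 0"
      using h0(1) unfolding k_def form_lincomb by auto
    moreover have "(sin \<theta>)\<^sup>2 + (cos \<theta>)\<^sup>2 = 1" by simp
    ultimately have "form d F ?u = 0" "form d G ?u = 0" by algebra+
    then show False using real_singular_not_base[OF S] by (simp add: base_def)
  qed
  have zero: "pencil_field d F G ?u = 0" using S chart_nonzero by (auto simp: pencil_field_zero_iff)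
  have "(pencil_field d F G has_derivative (\<lambda>h. - (k *\<^sub>R (?H *v h)))) (at ?u)"
    using pencil_field_has_derivative[of d "member \<theta>" ?K ?u] h0
    unfolding pencil_field_rotate k_def[symmetric] by simp
  from disc_field_has_derivative_at_zero[OF this zero]
  obtain p q where pq: "(disc_field d F G a b has_derivative (\<lambda>h. p * h + q * cnj h)) (at z)"
    "(cmod p)\<^sup>2 - (cmod q)\<^sup>2 = (- (k *\<^sub>R (?H *v ?X)) \<bullet> ?X) * (- (k *\<^sub>R (?H *v ?Y)) \<bullet> ?Y)
        - (- (k *\<^sub>R (?H *v ?Y)) \<bullet> ?X) * (- (k *\<^sub>R (?H *v ?X)) \<bullet> ?Y)" by blast
  define hx hy where "hx = ?H *v ?X" and "hy = ?H *v ?Y"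
  have sym: "?Y \<bullet> hx = ?X \<bullet> hy" unfolding hx_def hy_def by (rule form_hess_inner_sym)
  have "(cmod p)\<^sup>2 - (cmod q)\<^sup>2 = k\<^sup>2 * node_disc \<theta> a b z"
    unfolding pq(2) node_disc_def Let_def hx_def[symmetric] hy_def[symmetric]
    by (simp add: inner_commute[of hx] inner_commute[of hy] sym power2_eq_square algebra_simps)
  with pq(1) have "k\<^sup>2 > 0 \<and> (cmod p)\<^sup>2 - (cmod q)\<^sup>2 = k\<^sup>2 * node_disc \<theta> a b z \<and>
     (disc_field d F G a b has_derivative (\<lambda>h. p * h + q * cnj h)) (at z)" using \<open>k \<noteq> 0\<close> by simp
  then show ?thesis by blast
qed

section \<open>Finiteness of the zeros and choice of the line\<close>

lemma finite_disc_zeros: "finite {z \<in> cball 0 1. disc_field d F G a b z = 0}"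
proof (rule nondegenerate_zeros_finite[OF continuous_on_disc_field])
  fix z assume "disc_field d F G a b z = 0"
  then consider "base (chart a b z)" | \<theta> where "real_singular \<theta> (chart a b z)"
    using pencil_field_zero_iff[OF chart_nonzero] by (auto simp: disc_field_eq_0_iff)
  then show "\<exists>p q. cmod p \<noteq> cmod q \<and> (disc_field d F G a b has_derivative (\<lambda>h. p * h + q * cnj h)) (at z)"
  proof cases
    case 1
    then show ?thesis using disc_field_derivative_base by (metis less_irrefl)
  next
    case 2
    then show ?thesis
      using disc_field_derivative_node[OF 2] node_disc_nonzero[OF 2]
      by (metis diff_self less_irrefl mult_eq_0_iff)
  qed
qed

text \<open>The line with normal \<open>(1, s, s\<^sup>2)\<close> contains \<open>u\<close> only if
  \<open>s\<close> is a root of a nonzero polynomial of degree at most 2, so each of finitely many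
  points excludes finitely many \<open>s\<close>.\<close>

lemma exists_generic_line: "\<exists>a b. \<forall>z. cmod z = 1 \<longrightarrow> disc_field d F G a b z \<noteq> 0"
proof -
  \<comment> \<open>One chart suffices to list the zeros: its closed disc represents every
    projective point, so the zeros on other lines are multiples of elements of
    \<open>S\<close>.\<close>
  define S where "S = chart 0 0 ` {z \<in> cball 0 1. disc_field d F G 0 0 z = 0}"
  have "finite S" unfolding S_def using finite_disc_zeros by simp
  define bad where "bad u = {s. line_coord s (s\<^sup>2) u = 0}" for u
  have "finite (bad u)" if "u \<noteq> 0" for u
  proof -
    have "bad u = {s. poly [:u$1, u$2, u$3:] s = 0}"
      by (auto simp: bad_def line_coord_def power2_eq_square algebra_simps)
    moreover have "[:u$1, u$2, u$3:] \<noteq> 0" using that by (auto simp: vec_eq_iff forall_3)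
    ultimately show ?thesis using poly_roots_finite[of "[:u$1, u$2, u$3:]"] by simp
  qed
  then have "finite (\<Union>u\<in>S. bad u)"
    using \<open>finite S\<close> chart_nonzero unfolding S_def by blast
  then obtain s where s: "s \<notin> (\<Union>u\<in>S. bad u)"
    using ex_new_if_finite infinite_UNIV_char_0 by blast
  have "disc_field d F G s (s\<^sup>2) z \<noteq> 0" if z: "cmod z = 1" for z
  proof
    assume "disc_field d F G s (s\<^sup>2) z = 0"
    then have V: "pencil_field d F G (chart s (s\<^sup>2) z) = 0" by (simp add: disc_field_eq_0_iff)
    obtain w t where w: "w \<in> cball 0 1" "t \<noteq> 0" "chart s (s\<^sup>2) z = t *\<^sub>R chart 0 0 w"
      using chart_surj_closed chart_nonzero by blast
    have "pencil_field d F G (chart 0 0 w) = 0"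
      using V w(2) unfolding w(3) pencil_field_scale by simp
    then have "chart 0 0 w \<in> S" using w(1) unfolding S_def by (auto simp: disc_field_eq_0_iff)
    then have "line_coord s (s\<^sup>2) (chart 0 0 w) \<noteq> 0" using s by (auto simp: bad_def)
    moreover have "t * line_coord s (s\<^sup>2) (chart 0 0 w) = 0"
      using line_coord_chart[of s "s\<^sup>2" z] z unfolding w(3) line_coord_scale by simp
    ultimately show False using w(2) by simp
  qed
  then show ?thesis by blast
qed

section \<open>From zeros on the disc to members of the pencil\<close>

lemma real_singular_representative:
  assumes "\<theta> \<in> {0..<pi}" "singular_pt d (rmem F G \<theta>) v"
  shows "\<exists>u. real_singular \<theta> u"
proof -
  have "singular_pt d (rmem F G \<theta>) (\<chi> m. cnj (v$m))"
    using assms(2) unfolding rmem_eq by (rule singular_pt_cnj)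
  then have "ppt (\<chi> m. cnj (v$m)) = ppt v" using nodal assms by blast
  then obtain a u where "a \<noteq> 0" "a *s v = cvec u" using real_representative by blast
  then have "singular_pt d (rmem F G \<theta>) (cvec u)" using singular_pt_scale[OF assms(2)] by metis
  then show ?thesis using assms(1) by (auto simp: real_singular_iff)
qed

theorem nodal_count:
  shows "finite {\<theta>\<in>{0..<pi}. \<exists>v. node_pt d (rmem F G \<theta>) v}"
    and "int (card {\<theta>\<in>{0..<pi}. \<exists>v. crossing_node d (rmem F G \<theta>) v})
         - int (card {\<theta>\<in>{0..<pi}. \<exists>v. solitary_node d (rmem F G \<theta>) v})
         = int (card {P \<in> base_points d F G. real_ppt P}) - 1"
proof -
  obtain a b where generic: "\<And>z. cmod z = 1 \<Longrightarrow> disc_field d F G a b z \<noteq> 0"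
    using exists_generic_line by blast
  let ?c = "chart a b"
  let ?W = "disc_field d F G a b"
  have W0: "?W z = 0 \<longleftrightarrow> base (?c z) \<or> (\<exists>\<theta>. real_singular \<theta> (?c z))" for z
    using pencil_field_zero_iff[OF chart_nonzero] by (simp add: disc_field_eq_0_iff)
  \<comment> \<open>The chosen line avoids all zeros, so each one is represented in the open disc,
    where \<open>chart_inj\<close> makes the representative unique.\<close>
  have in_chart: "\<exists>z t. z \<in> ball 0 1 \<and> t \<noteq> 0 \<and> u = t *\<^sub>R ?c z"
    if u: "u \<noteq> 0" "pencil_field d F G u = 0" for u
  proof -
    obtain z t where z: "z \<in> cball 0 1" "t \<noteq> 0" "u = t *\<^sub>R ?c z" using chart_surj_closed u(1) by blast
    then have "?W z = 0" using u(2) by (simp add: pencil_field_scale disc_field_eq_0_iff)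
    then have "cmod z \<noteq> 1" using generic by blast
    then show ?thesis using z by force
  qed
  define Zb where "Zb = {z \<in> ball 0 1. base (?c z)}"
  define Zc where "Zc = {z \<in> ball 0 1. \<exists>\<theta>. real_singular \<theta> (?c z) \<and> crossing_node d (rmem F G \<theta>) (cvec (?c z))}"
  define Zs where "Zs = {z \<in> ball 0 1. \<exists>\<theta>. real_singular \<theta> (?c z) \<and> solitary_node d (rmem F G \<theta>) (cvec (?c z))}"
  have zeros: "{z \<in> cball 0 1. ?W z = 0} = (Zb \<union> Zs) \<union> Zc"
  proof (intro set_eqI iffI)
    fix z assume z: "z \<in> {z \<in> cball 0 1. ?W z = 0}"
    then have "cmod z \<noteq> 1" using generic by auto
    then have "z \<in> ball 0 1" using z by auto
    then show "z \<in> (Zb \<union> Zs) \<union> Zc"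
      using z node_type_chart node_disc_nonzero unfolding Zb_def Zs_def Zc_def mem_Collect_eq W0
      by (smt (verit) UnCI mem_Collect_eq)
  qed (auto simp: Zb_def Zs_def Zc_def W0)
  have fin: "finite ((Zb \<union> Zs) \<union> Zc)" using finite_disc_zeros zeros by metis
  have disj: "Zb \<inter> Zs = {}" "Zb \<inter> Zc = {}" "Zs \<inter> Zc = {}"
  proof -
    show "Zb \<inter> Zs = {}" "Zb \<inter> Zc = {}"
      using real_singular_not_base unfolding Zb_def Zs_def Zc_def by blast+
    show "Zs \<inter> Zc = {}"
    proof (rule ccontr)
      assume "Zs \<inter> Zc \<noteq> {}"
      then obtain z \<theta> \<phi> where z: "real_singular \<theta> (?c z)" "crossing_node d (rmem F G \<theta>) (cvec (?c z))"
        "real_singular \<phi> (?c z)" "solitary_node d (rmem F G \<phi>) (cvec (?c z))"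
        unfolding Zs_def Zc_def by blast
      then have "\<theta> = \<phi>" using real_singular_angle_unique by blast
      then show False using z node_type_chart by fastforce
    qed
  qed
  \<comment> \<open>Base points and solitary nodes have positive Jacobian determinant, crossings
    negative.\<close>
  have index: "int (card (Zb \<union> Zs)) - int (card Zc) = 1"
  proof (rule index_sum_eq_one[OF continuous_on_disc_field zeros fin])
    show "(Zb \<union> Zs) \<inter> Zc = {}" using disj by blast
    show "(Zb \<union> Zs) \<union> Zc \<subseteq> ball 0 1" by (auto simp: Zb_def Zs_def Zc_def)
    show "?W (- z) * cnj (- z) = - cnj (?W z * cnj z)" if "cmod z = 1" for z
      using disc_field_antipodal that degree by simp
    have lt: "cmod q < cmod p" if "(cmod p)\<^sup>2 - (cmod q)\<^sup>2 > 0" for p q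
      using that by (intro power2_less_imp_less[of "cmod q" "cmod p"]) auto
    show "\<exists>p q. cmod q < cmod p \<and> (?W has_derivative (\<lambda>h. p * h + q * cnj h)) (at z)" if z: "z \<in> Zb \<union> Zs" for z
    proof (cases "base (?c z)")
      case True
      then show ?thesis by (rule disc_field_derivative_base)
    next
      case False
      then obtain \<theta> where S: "real_singular \<theta> (?c z)" "node_disc \<theta> a b z > 0"
        using z node_type_chart(2) by (auto simp: Zb_def Zs_def)
      then show ?thesis using disc_field_derivative_node[OF S(1)] lt by (metis mult_pos_pos)
    qed
    show "\<exists>p q. cmod p < cmod q \<and> (?W has_derivative (\<lambda>h. p * h + q * cnj h)) (at z)" if z: "z \<in> Zc" for z
    proof -
      obtain \<theta> where S: "real_singular \<theta> (?c z)" "node_disc \<theta> a b z < 0"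
        using z node_type_chart(1) by (auto simp: Zc_def)
      obtain p q k where pq: "k > 0" "(cmod p)\<^sup>2 - (cmod q)\<^sup>2 = k * node_disc \<theta> a b z"
        "(?W has_derivative (\<lambda>h. p * h + q * cnj h)) (at z)"
        using disc_field_derivative_node[OF S(1)] by blast
      have "(cmod p)\<^sup>2 - (cmod q)\<^sup>2 < 0" using pq S(2) by (simp add: mult_pos_neg)
      then have "cmod p < cmod q" by (intro lt) simp
      then show ?thesis using pq(3) by blast
    qed
  qed
  have base_bij: "bij_betw (\<lambda>z. ppt (cvec (?c z))) Zb {P \<in> base_points d F G. real_ppt P}"
    unfolding bij_betw_def
  proof (intro conjI inj_onI subset_antisym subsetI)
    fix z w assume zw: "z \<in> Zb" "w \<in> Zb" "ppt (cvec (?c z)) = ppt (cvec (?c w))"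
    then have "cvec (?c z) \<in> ppt (cvec (?c w))" using in_ppt_self by metis
    then obtain k where "cvec (?c z) = k *s cvec (?c w)" unfolding ppt_def by blast
    then have "?c z = Re k *\<^sub>R ?c w" using cvec_multiple_real chart_nonzero by blast
    then show "z = w" using chart_inj zw unfolding Zb_def by blast
  next
    fix P assume "P \<in> (\<lambda>z. ppt (cvec (?c z))) ` Zb"
    then obtain z where z: "P = ppt (cvec (?c z))" "base (?c z)" by (auto simp: Zb_def)
    then show "P \<in> {P \<in> base_points d F G. real_ppt P}"
      using base_imp_base_points chart_nonzero in_ppt_self realvec_cvec unfolding real_ppt_def by blast
  next
    fix P assume "P \<in> {P \<in> base_points d F G. real_ppt P}"
    then obtain v w where v: "P = ppt v" "v \<noteq> 0" "heval d (pmem F G 1 0) v = 0" "heval d (pmem F G 0 1) v = 0"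
      and w: "w \<in> P" "realvec w" by (auto simp: base_points_def real_ppt_def)
    obtain k where k: "w = k *s v" "k \<noteq> 0" using v(1) w(1) unfolding ppt_def by blast
    obtain u where u: "w = cvec u" using realvec_imp_cvec w(2) by blast
    have P: "P = ppt (cvec u)" using ppt_scale[OF k(2)] k(1) v(1) u by simp
    have "u \<noteq> 0" using k v(2) u by (metis cvec_eq_0 vector_mul_eq_0)
    have "heval d c (k *s v) = k ^ d * heval d c v" for c
      by (simp add: heval_def mono_scale sum_distrib_left degd_def algebra_simps)
    then have "base u" using v(3,4) k(1) u heval_base[of u] by (simp add: base_def)
    then obtain z t where z: "z \<in> ball 0 1" "t \<noteq> 0" "u = t *\<^sub>R ?c z"
      using in_chart \<open>u \<noteq> 0\<close> pencil_field_zero_iff by blast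
    have "z \<in> Zb" using z \<open>base u\<close> by (simp add: Zb_def base_def form_scale)
    moreover have "P = ppt (cvec (?c z))" unfolding P z(3) cvec_scaleR by (rule ppt_scale) (use z(2) in simp)
    ultimately show "P \<in> (\<lambda>z. ppt (cvec (?c z))) ` Zb" by blast
  qed
  \<comment> \<open>Abstracting the node type lets one bijection argument serve both; scale
    invariance is required since a given node is only a multiple of a chart point.\<close>
  define T where "T N = {\<theta>\<in>{0..<pi}. \<exists>v. N d (rmem F G \<theta>) v}"
    for N :: "nat \<Rightarrow> (nat^3 \<Rightarrow> complex) \<Rightarrow> complex^3 \<Rightarrow> bool"
  have node_bij: "\<exists>f. bij_betw f {z \<in> ball 0 1. \<exists>\<theta>. real_singular \<theta> (?c z) \<and> N d (rmem F G \<theta>) (cvec (?c z))} (T N)"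
    if N: "\<And>\<theta> v. N d (rmem F G \<theta>) v \<Longrightarrow> singular_pt d (rmem F G \<theta>) v \<and> realvec v"
      "\<And>\<theta> u t. real_singular \<theta> u \<Longrightarrow> t \<noteq> 0 \<Longrightarrow> N d (rmem F G \<theta>) (cvec (t *\<^sub>R u)) \<longleftrightarrow> N d (rmem F G \<theta>) (cvec u)"
    for N
  proof (rule bij_betw_of_relation[where R = "\<lambda>z \<theta>. real_singular \<theta> (?c z) \<and> N d (rmem F G \<theta>) (cvec (?c z))"])
    fix z assume "z \<in> {z \<in> ball 0 1. \<exists>\<theta>. real_singular \<theta> (?c z) \<and> N d (rmem F G \<theta>) (cvec (?c z))}"
    then show "\<exists>\<theta>\<in>T N. real_singular \<theta> (?c z) \<and> N d (rmem F G \<theta>) (cvec (?c z))"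
      unfolding T_def real_singular_iff by blast
  next
    fix \<theta> assume "\<theta> \<in> T N"
    then obtain v where v: "\<theta> \<in> {0..<pi}" "N d (rmem F G \<theta>) v" by (auto simp: T_def)
    then obtain u where u: "v = cvec u" using N(1) realvec_imp_cvec by blast
    have S: "real_singular \<theta> u" using v N(1) u by (auto simp: real_singular_iff)
    then obtain z t where z: "z \<in> ball 0 1" "t \<noteq> 0" "u = t *\<^sub>R ?c z"
      using in_chart pencil_field_zero_iff unfolding real_singular_def by blast
    have S': "real_singular \<theta> (?c z)" using real_singular_scale[OF S, of "1 / t"] z by simp
    have "N d (rmem F G \<theta>) (cvec (?c z))" using N(2)[OF S' z(2)] v(2) u z(3) by simp
    then show "\<exists>z\<in>{z \<in> ball 0 1. \<exists>\<theta>. real_singular \<theta> (?c z) \<and> N d (rmem F G \<theta>) (cvec (?c z))}.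
        real_singular \<theta> (?c z) \<and> N d (rmem F G \<theta>) (cvec (?c z))"
      using z(1) S' by blast
  next
    fix z w \<theta>
    assume "z \<in> {z \<in> ball 0 1. \<exists>\<theta>. real_singular \<theta> (?c z) \<and> N d (rmem F G \<theta>) (cvec (?c z))}"
      "w \<in> {z \<in> ball 0 1. \<exists>\<theta>. real_singular \<theta> (?c z) \<and> N d (rmem F G \<theta>) (cvec (?c z))}"
      "real_singular \<theta> (?c z) \<and> N d (rmem F G \<theta>) (cvec (?c z))"
      "real_singular \<theta> (?c w) \<and> N d (rmem F G \<theta>) (cvec (?c w))"
    then show "z = w" using real_singular_unique chart_inj by blast
  qed (use real_singular_angle_unique in blast)
  have bij_c: "\<exists>f. bij_betw f Zc (T crossing_node)"
    unfolding Zc_def by (rule node_bij, simp add: crossing_node_def node_pt_def, rule node_type_scale(1))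
  have bij_s: "\<exists>f. bij_betw f Zs (T solitary_node)"
    unfolding Zs_def by (rule node_bij, simp add: solitary_node_def node_pt_def, rule node_type_scale(2))
  have card_T: "card Zc = card (T crossing_node)" "card Zs = card (T solitary_node)"
    using bij_c bij_s bij_betw_same_card by blast+
  have "card (Zb \<union> Zs) = card Zb + card Zs" using fin disj by (intro card_Un_disjoint) auto
  then show "int (card {\<theta>\<in>{0..<pi}. \<exists>v. crossing_node d (rmem F G \<theta>) v})
         - int (card {\<theta>\<in>{0..<pi}. \<exists>v. solitary_node d (rmem F G \<theta>) v})
         = int (card {P \<in> base_points d F G. real_ppt P}) - 1"
    using index card_T bij_betw_same_card[OF base_bij] unfolding T_def by simp
  have "finite (T crossing_node)" "finite (T solitary_node)"
    using bij_c bij_s fin bij_betw_finite by blast+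
  \<comment> \<open>A node is at first complex; the real representative of the singular point makes
    it one of the two real types.\<close>
  moreover have "T node_pt \<subseteq> T crossing_node \<union> T solitary_node"
  proof
    fix \<theta> assume "\<theta> \<in> T node_pt"
    then obtain v where "\<theta> \<in> {0..<pi}" "singular_pt d (rmem F G \<theta>) v" by (auto simp: T_def node_pt_def)
    then obtain u where S: "real_singular \<theta> u" using real_singular_representative by blast
    then obtain z t where z: "z \<in> ball 0 1" "t \<noteq> 0" "u = t *\<^sub>R ?c z"
      using in_chart pencil_field_zero_iff unfolding real_singular_def by blast
    have S': "real_singular \<theta> (?c z)" using real_singular_scale[OF S, of "1 / t"] z by simp
    then show "\<theta> \<in> T crossing_node \<union> T solitary_node"
      using node_type_chart[OF S'] node_disc_nonzero[OF S'] unfolding T_def real_singular_iff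
      by (metis (mono_tags, lifting) UnCI linorder_neqE_linordered_idom mem_Collect_eq)
  qed
  ultimately show "finite {\<theta>\<in>{0..<pi}. \<exists>v. node_pt d (rmem F G \<theta>) v}"
    unfolding T_def by (meson finite_UnI finite_subset)
qed

end

theorem mainTheorem9:
  fixes d r :: nat and F G :: "nat^3 \<Rightarrow> real"
  assumes "d \<ge> 2"
    and "card (base_points d F G) = d^2"
    and "card {P \<in> base_points d F G. \<not> real_ppt P} = 2 * r"
    and "\<forall>\<theta>\<in>{0..<pi}. \<forall>v. singular_pt d (rmem F G \<theta>) v \<longrightarrow>
            node_pt d (rmem F G \<theta>) v \<and> ppt v \<notin> base_points d F G \<and>
            (\<forall>w. singular_pt d (rmem F G \<theta>) w \<longrightarrow> ppt w = ppt v)"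
  shows "(int (card {\<theta>\<in>{0..<pi}. \<exists>v. crossing_node d (rmem F G \<theta>) v})
         - int (card {\<theta>\<in>{0..<pi}. \<exists>v. solitary_node d (rmem F G \<theta>) v})
         = int d^2 - 1 - 2 * int r) \<and>
         (r = 0 \<longrightarrow> card {\<theta>\<in>{0..<pi}. \<exists>v. node_pt d (rmem F G \<theta>) v} \<ge> d^2 - 1)"
proof -
  interpret nodal_pencil d F G using assms(1,4) by unfold_locales
  let ?B = "base_points d F G"
  \<comment> \<open>An infinite set would have cardinality 0, whereas
    \<open>d\<^sup>2 > 0\<close>.\<close>
  have "finite ?B" by (rule card_ge_0_finite) (use assms(1,2) in simp)
  then have "card {P \<in> ?B. real_ppt P} + card {P \<in> ?B. \<not> real_ppt P} = card ({P \<in> ?B. real_ppt P} \<union> {P \<in> ?B. \<not> real_ppt P})"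
    by (intro card_Un_disjoint[symmetric]) auto
  also have "{P \<in> ?B. real_ppt P} \<union> {P \<in> ?B. \<not> real_ppt P} = ?B" by auto
  finally have "int (card {P \<in> ?B. real_ppt P}) + 2 * int r = int d ^ 2"
    using assms(2,3) by (metis of_nat_add of_nat_mult of_nat_numeral of_nat_power)
  with nodal_count(2) have count: "int (card {\<theta>\<in>{0..<pi}. \<exists>v. crossing_node d (rmem F G \<theta>) v})
         - int (card {\<theta>\<in>{0..<pi}. \<exists>v. solitary_node d (rmem F G \<theta>) v}) = int d^2 - 1 - 2 * int r"
    by linarith
  moreover have "d\<^sup>2 - 1 \<le> card {\<theta>\<in>{0..<pi}. \<exists>v. node_pt d (rmem F G \<theta>) v}" if "r = 0"
  proof -
    \<comment> \<open>Crossings alone reach the bound, as their number is at least the difference.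
      Finiteness matters: \<open>card\<close> would be 0 on an infinite set of angles.\<close>
    have "card {\<theta>\<in>{0..<pi}. \<exists>v. crossing_node d (rmem F G \<theta>) v} \<le> card {\<theta>\<in>{0..<pi}. \<exists>v. node_pt d (rmem F G \<theta>) v}"
      by (intro card_mono nodal_count(1)) (auto simp: crossing_node_def)
    moreover have "int (d\<^sup>2 - 1) = int d ^ 2 - 1" using assms(1) by (simp add: of_nat_diff)
    ultimately show ?thesis using count that by linarith
  qed
  ultimately show ?thesis by blast
qed

end
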